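(* Every $\xi\in\mathfrak{S}$ admits a decomposition $$\xi=\mu-\alpha\qquad(\ast)$$ where $\mu$ is a finitely additive martingale and $\alpha$ is a positive, finitely additive increasing process. Moreover, for $\xi\in\mathfrak{S}$ the following are equivalent: (i) $\xi\in\mathfrak{S}^{uc}$; (ii) $\mu$ and $\alpha$ in $(\ast)$ may be chosen such that $\mu_\infty,\alpha_\infty\in ca(\mathcal{A})$ (and thus so that $\mu$ and $\alpha$ are countably additive processes); (iii) there exists $\lambda\in ca(\mathcal{A})_+$ such that $|\xi_t|\le\lambda|_{\mathcal{A}_t}$ for each $t\in\mathbb{R}_+$.
   Context: $\Omega$ is a set, $(\mathcal{A}_t)_{t\in\mathbb{R}_+}$ an increasing family of algebras of subsets of $\Omega$, $\mathcal{A}=\bigcup_{t\in\mathbb{R}_+}\mathcal{A}_t$, and $\mathcal{F}$ the $\sigma$-algebra generated by $\mathcal{A}$. For an algebra $\mathcal{G}$, $ba(\mathcal{G})$ is the Banach lattice of bounded finitely additive real set functions on $\mathcal{G}$ (total variation norm), $ca(\mathcal{G})\subset ba(\mathcal{G})$ the countably additive ones, and a subscript $+$ denotes positive elements. A finitely additive process is a family $\xi=(\xi_t)_{t\in\mathbb{R}_+}$ with $\xi_t\in ba(\mathcal{A}_t)$; it is a finitely additive supermartingale if $\xi_t(F)\ge\xi_u(F)$ for $t\le u$, $F\in\mathcal{A}_t$, and a finitely additive martingale if equality always holds. $\mathfrak{S}$ is the set of finitely additive supermartingales with $\sup_t\|\xi_t\|<\infty$. For $\xi\in\mathfrak{S}$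 and $F\in\mathcal{A}$, $\xi_\infty(F)=\inf_{\{t:F\in\mathcal{A}_t\}}\xi_t(F)$. For a martingale $\mu$ (resp. an increasing process $\alpha$) $\mu_\infty(F)=\lim_t\mu_t(F)$ (resp. $\alpha_\infty(F)=\lim_t\alpha_t(F)$) for $F\in\mathcal{A}$. A positive finitely additive increasing process is a family $\alpha=(\alpha_t)_{t\in\mathbb{R}_+}$ with $\alpha_t\in ba(\mathcal{A}_t)_+$ for which there is a family $(\bar\alpha_t)_{t\in\mathbb{R}_+}$ in $ba(\mathcal{A})_+$, increasing in $t$, with $\bar\alpha_t|_{\mathcal{A}_t}=\alpha_t$ for every $t$ and $\inf_t\|\bar\alpha_t\|=\|\alpha_0\|=0$. Let $\bar\Omega=\Omega\times\mathbb{R}_+$, $\bar{\mathcal{F}}=\{F\times\mathbb{R}_+:F\in\mathcal{F}\}$ and $\mathfrak{M}=\{\bar x\in ba(2^{\bar\Omega})_+:\lim_{t\to\infty}\bar x(\Omega\times]t,\infty[)=0\}$. For $\xi\in\mathfrak{S}$, $\mathfrak{M}(\xi)$ is the set of $\bar x\in\mathfrak{M}$ with $\xi_t(F)=\xi_\infty(F)+\bar x(F\times]t,\infty[)$ for all $t\in\mathbb{R}_+$, $F\in\mathcal{A}_t$. $\mathfrak{M}^{uc}$ is the set of $\bar x\in\mathfrak{M}$ with $\bar x|_{\bar{\mathcal{F}}}\in ca(\bar{\mathcal{F}})$, and $$\mathfrak{S}^{uc}=\{\xi\in\mathfrak{S}:\ \xi_\infty\in ca(\mathcal{A}),\ \mathfrak{M}(\xi)\cap\mathfrak{M}^{uc}\ne\varnothing\}.$$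 *)

theory Defs
  imports "HOL-Analysis.Analysis"
begin

text \<open>
  A set function on an algebra \<open>G\<close> is represented by a total function \<open>'a set \<Rightarrow> real\<close> of which
  only the values on \<open>G\<close> matter: restriction to a subalgebra is left implicit, and every
  comparison of set functions is made on the members of the relevant algebra. Likewise,
  processes are functions of a real time of which only the values at times \<open>t \<ge> 0\<close> matter.
\<close>

definition ba :: "'a set set \<Rightarrow> ('a set \<Rightarrow> real) set" where
  "ba G = {m. additive G m \<and> bounded (m ` G)}"

text \<open>
  The library's \<open>countably_additive\<close> is restricted to \<open>ennreal\<close>-valued functions. Boundedness is
  not automatic on an algebra that is not a sigma-algebra, hence the intersection with \<open>ba\<close>.
\<close>

definition ca :: "'a set set \<Rightarrow> ('a set \<Rightarrow> real) set" where
  "ca G = {m \<in> ba G. \<forall>B :: nat \<Rightarrow> 'a set.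
     range B \<subseteq> G \<longrightarrow> disjoint_family B \<longrightarrow> (\<Union>i. B i) \<in> G \<longrightarrow> (\<lambda>i. m (B i)) sums m (\<Union>i. B i)}"

definition nonneg_on :: "'a set set \<Rightarrow> ('a set \<Rightarrow> real) \<Rightarrow> bool" where
  "nonneg_on G m \<longleftrightarrow> (\<forall>F\<in>G. 0 \<le> m F)"

definition ba_pos :: "'a set set \<Rightarrow> ('a set \<Rightarrow> real) set" where
  "ba_pos G = {m \<in> ba G. nonneg_on G m}"

definition ca_pos :: "'a set set \<Rightarrow> ('a set \<Rightarrow> real) set" where
  "ca_pos G = {m \<in> ca G. nonneg_on G m}"

text \<open>
  For \<open>m \<in> ba G\<close>, \<open>variation G m\<close> is the modulus \<open>\<bar>m\<bar>\<close> in the lattice \<open>ba G\<close>; the supremum is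
  finite because \<open>m\<close> is bounded.
\<close>

definition variation :: "'a set set \<Rightarrow> ('a set \<Rightarrow> real) \<Rightarrow> 'a set \<Rightarrow> real" where
  "variation G m E = (SUP P \<in> {P. finite P \<and> P \<subseteq> G \<and> partition_on E P}. \<Sum>F\<in>P. \<bar>m F\<bar>)"

definition tv_norm :: "'a set \<Rightarrow> 'a set set \<Rightarrow> ('a set \<Rightarrow> real) \<Rightarrow> real" where
  "tv_norm \<Omega> G m = variation G m \<Omega>"

definition algebra_filtration :: "'a set \<Rightarrow> (real \<Rightarrow> 'a set set) \<Rightarrow> bool" where
  "algebra_filtration \<Omega> A \<longleftrightarrow>
     (\<forall>t\<ge>0. algebra \<Omega> (A t)) \<and> (\<forall>s t. 0 \<le> s \<longrightarrow> s \<le> t \<longrightarrow> A s \<subseteq> A t)"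

definition union_algebra :: "(real \<Rightarrow> 'a set set) \<Rightarrow> 'a set set" where
  "union_algebra A = (\<Union>t\<in>{0..}. A t)"

definition fa_process :: "(real \<Rightarrow> 'a set set) \<Rightarrow> (real \<Rightarrow> 'a set \<Rightarrow> real) \<Rightarrow> bool" where
  "fa_process A \<xi> \<longleftrightarrow> (\<forall>t\<ge>0. \<xi> t \<in> ba (A t))"

definition ca_process :: "(real \<Rightarrow> 'a set set) \<Rightarrow> (real \<Rightarrow> 'a set \<Rightarrow> real) \<Rightarrow> bool" where
  "ca_process A \<xi> \<longleftrightarrow> (\<forall>t\<ge>0. \<xi> t \<in> ca (A t))"

definition fa_supermartingale :: "(real \<Rightarrow> 'a set set) \<Rightarrow> (real \<Rightarrow> 'a set \<Rightarrow> real) \<Rightarrow> bool" where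
  "fa_supermartingale A \<xi> \<longleftrightarrow> fa_process A \<xi> \<and>
     (\<forall>t u. 0 \<le> t \<longrightarrow> t \<le> u \<longrightarrow> (\<forall>F\<in>A t. \<xi> t F \<ge> \<xi> u F))"

definition fa_martingale :: "(real \<Rightarrow> 'a set set) \<Rightarrow> (real \<Rightarrow> 'a set \<Rightarrow> real) \<Rightarrow> bool" where
  "fa_martingale A \<mu> \<longleftrightarrow> fa_process A \<mu> \<and>
     (\<forall>t u. 0 \<le> t \<longrightarrow> t \<le> u \<longrightarrow> (\<forall>F\<in>A t. \<mu> t F = \<mu> u F))"

definition bdd_supermartingales ::
  "'a set \<Rightarrow> (real \<Rightarrow> 'a set set) \<Rightarrow> (real \<Rightarrow> 'a set \<Rightarrow> real) set" where
  "bdd_supermartingales \<Omega> A =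
     {\<xi>. fa_supermartingale A \<xi> \<and> bdd_above ((\<lambda>t. tv_norm \<Omega> (A t) (\<xi> t)) ` {0..})}"

definition fa_increasing_process ::
  "'a set \<Rightarrow> (real \<Rightarrow> 'a set set) \<Rightarrow> (real \<Rightarrow> 'a set \<Rightarrow> real) \<Rightarrow> bool" where
  "fa_increasing_process \<Omega> A \<alpha> \<longleftrightarrow>
     (\<forall>t\<ge>0. \<alpha> t \<in> ba_pos (A t)) \<and>
     (\<exists>\<beta> :: real \<Rightarrow> 'a set \<Rightarrow> real.
        (\<forall>t\<ge>0. \<beta> t \<in> ba_pos (union_algebra A)) \<and>
        (\<forall>s t. 0 \<le> s \<longrightarrow> s \<le> t \<longrightarrow> (\<forall>F\<in>union_algebra A. \<beta> s F \<le> \<beta> t F)) \<and>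
        (\<forall>t\<ge>0. \<forall>F\<in>A t. \<beta> t F = \<alpha> t F) \<and>
        (INF t\<in>{0..}. tv_norm \<Omega> (union_algebra A) (\<beta> t)) = tv_norm \<Omega> (A 0) (\<alpha> 0) \<and>
        tv_norm \<Omega> (A 0) (\<alpha> 0) = 0)"

text \<open>
  \<open>inf_value A \<xi>\<close> is \<open>\<xi>\<^sub>\<infinity>\<close> for a supermartingale \<open>\<xi>\<close>, whereas \<open>lim_value\<close> is the terminal value
  of martingales and of increasing processes. Each \<open>F \<in> union_algebra A\<close> belongs to \<open>A t\<close> for
  all large \<open>t\<close>, so the limit does not depend on irrelevant values.
\<close>

definition inf_value ::
  "(real \<Rightarrow> 'a set set) \<Rightarrow> (real \<Rightarrow> 'a set \<Rightarrow> real) \<Rightarrow> 'a set \<Rightarrow> real" where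
  "inf_value A \<xi> F = (INF t\<in>{t. 0 \<le> t \<and> F \<in> A t}. \<xi> t F)"

definition lim_value :: "(real \<Rightarrow> 'a set \<Rightarrow> real) \<Rightarrow> 'a set \<Rightarrow> real" where
  "lim_value \<xi> F = Lim at_top (\<lambda>t. \<xi> t F)"

definition fa_decomposition :: "'a set \<Rightarrow> (real \<Rightarrow> 'a set set) \<Rightarrow> (real \<Rightarrow> 'a set \<Rightarrow> real) \<Rightarrow>
    (real \<Rightarrow> 'a set \<Rightarrow> real) \<Rightarrow> (real \<Rightarrow> 'a set \<Rightarrow> real) \<Rightarrow> bool" where
  "fa_decomposition \<Omega> A \<xi> \<mu> \<alpha> \<longleftrightarrow>
     fa_martingale A \<mu> \<and> fa_increasing_process \<Omega> A \<alpha> \<and>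
     (\<forall>t\<ge>0. \<forall>F\<in>A t. \<xi> t F = \<mu> t F - \<alpha> t F)"

definition time_product :: "'a set \<Rightarrow> ('a \<times> real) set" where
  "time_product \<Omega> = \<Omega> \<times> {0..}"

definition time_cylinders :: "'a set \<Rightarrow> (real \<Rightarrow> 'a set set) \<Rightarrow> ('a \<times> real) set set" where
  "time_cylinders \<Omega> A = {F \<times> {0..} |F. F \<in> sigma_sets \<Omega> (union_algebra A)}"

definition prod_measures :: "'a set \<Rightarrow> (('a \<times> real) set \<Rightarrow> real) set" where
  "prod_measures \<Omega> =
     {x \<in> ba_pos (Pow (time_product \<Omega>)). ((\<lambda>t. x (\<Omega> \<times> {t<..})) \<longlongrightarrow> 0) at_top}"

definition prod_measures_of :: "'a set \<Rightarrow> (real \<Rightarrow> 'a set set) \<Rightarrow> (real \<Rightarrow> 'a set \<Rightarrow> real) \<Rightarrow>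
    (('a \<times> real) set \<Rightarrow> real) set" where
  "prod_measures_of \<Omega> A \<xi> =
     {x \<in> prod_measures \<Omega>. \<forall>t\<ge>0. \<forall>F\<in>A t. \<xi> t F = inf_value A \<xi> F + x (F \<times> {t<..})}"

definition prod_measures_uc ::
  "'a set \<Rightarrow> (real \<Rightarrow> 'a set set) \<Rightarrow> (('a \<times> real) set \<Rightarrow> real) set" where
  "prod_measures_uc \<Omega> A = {x \<in> prod_measures \<Omega>. x \<in> ca (time_cylinders \<Omega> A)}"

definition uc_supermartingales ::
  "'a set \<Rightarrow> (real \<Rightarrow> 'a set set) \<Rightarrow> (real \<Rightarrow> 'a set \<Rightarrow> real) set" where
  "uc_supermartingales \<Omega> A =
     {\<xi> \<in> bdd_supermartingales \<Omega> A. inf_value A \<xi> \<in> ca (union_algebra A) \<and>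
        prod_measures_of \<Omega> A \<xi> \<inter> prod_measures_uc \<Omega> A \<noteq> {}}"

end

theory Submission
  imports Defs
begin

text \<open>
  Write \<open>\<xi>\<^sub>\<infinity>\<close> for the pointwise infimum of the supermartingale \<open>\<xi>\<close>. The differences
  \<open>\<pi>\<^sub>t = \<xi>\<^sub>t - \<xi>\<^sub>\<infinity>\<close> are positive, decrease in \<open>t\<close> and tend to \<open>0\<close>. The whole result comes from
  realising them as the tails of one positive additive set function \<open>x\<close> on all subsets of
  \<open>\<Omega> \<times> [0, \<infinity>)\<close>: \<open>x (F \<times> (t, \<infinity>)) = \<pi>\<^sub>t F\<close> for \<open>F \<in> A\<^sub>t\<close>, a finitely additive Doleans measure.
  The decomposition is then read off (\<open>decomposition_of_prod_measure\<close>): \<open>\<alpha>\<^sub>t F = x (F \<times> (0, t])\<close>, and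
  \<open>\<mu> = \<xi> + \<alpha>\<close> has the value \<open>\<xi>\<^sub>\<infinity> F + x (F \<times> (0, \<infinity>))\<close> at every \<open>t\<close> with \<open>F \<in> A\<^sub>t\<close>.

  The existence of \<open>x\<close> (\<open>potential_representation\<close>) is a compactness argument. By Tychonoff's
  theorem it suffices to satisfy finitely many of the required equations, which involves finitely
  many times and finite algebras only. The times are then treated backwards
  (\<open>finite_times_interpolation\<close>): the mass still missing at a time is a positive additive function
  on a finite algebra, and it is extended to all subsets (\<open>finite_algebra_extension\<close>) and placed on
  a single slice of the product. The extension can be kept below any additive \<open>\<rho>\<close> that dominates the
  potential, so that the time marginal \<open>B \<mapsto> x (B \<times> [0, \<infinity>))\<close> of \<open>x\<close> also lies below \<open>\<rho>\<close>. Without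
  a global dominant, a suitable \<open>\<rho>\<close> is available for each finite algebra separately.

  The equivalences follow because countable additivity is inherited by dominated set functions
  (\<open>ca_dominated\<close>). From (i) to (ii), the countably additive time marginal of \<open>x\<close> dominates the
  terminal value of \<open>\<alpha>\<close>. From (ii) to (iii), \<open>\<bar>\<xi>\<^sub>t\<bar>\<close> lies below the sum of the modulus of the
  terminal value of \<open>\<mu>\<close> and the terminal value of \<open>\<alpha>\<close>. From (iii) to (i), the potential lies below
  \<open>2\<lambda>\<close>, which extends to the generated sigma-algebra by Caratheodory's theorem and then additively to
  a \<open>\<rho>\<close> on all subsets; an \<open>x\<close> with time marginal below \<open>\<rho>\<close> is countably additive on cylinders.
\<close>

section \<open>Bounded and countably additive set functions\<close>

lemma additive_empty:
  fixes m :: "'b set \<Rightarrow> real"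
  assumes "additive G m" "{} \<in> G"
  shows "m {} = 0"
  using additiveD[OF assms(1), of "{}" "{}"] assms(2) by simp

lemma additive_subset: "additive G m \<Longrightarrow> H \<subseteq> G \<Longrightarrow> additive H m"
  unfolding additive_def by blast

lemma (in ring_of_sets) additive_Diff:
  fixes m :: "'a set \<Rightarrow> real"
  assumes "additive M m" "E \<in> M" "F \<in> M" "E \<subseteq> F"
  shows "m (F - E) = m F - m E"
  using additiveD[OF assms(1), of E "F - E"] assms by (simp add: Un_absorb1 Diff)

lemma (in ring_of_sets) additive_UN:
  fixes m :: "'a set \<Rightarrow> real"
  assumes "additive M m" "finite I" "disjoint_family_on B I" "\<And>i. i \<in> I \<Longrightarrow> B i \<in> M"
  shows "m (\<Union>i\<in>I. B i) = (\<Sum>i\<in>I. m (B i))"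
  using assms(2,3,4)
proof (induction I rule: finite_induct)
  case empty
  then show ?case using additive_empty[OF assms(1)] by simp
next
  case (insert i I)
  have "B i \<inter> (\<Union>j\<in>I. B j) = {}"
    using insert.prems(1) insert.hyps(2) by (fastforce simp: disjoint_family_on_def)
  then have "m (B i \<union> (\<Union>j\<in>I. B j)) = m (B i) + m (\<Union>j\<in>I. B j)"
    using insert by (intro additiveD[OF assms(1)]) auto
  moreover have "m (\<Union>j\<in>I. B j) = (\<Sum>j\<in>I. m (B j))"
    using insert by (intro insert.IH) (auto simp: disjoint_family_on_def)
  ultimately show ?case using insert.hyps by simp
qed

lemma (in ring_of_sets) additive_mono:
  fixes m :: "'a set \<Rightarrow> real"
  assumes "additive M m" "nonneg_on M m" "E \<in> M" "F \<in> M" "E \<subseteq> F"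
  shows "m E \<le> m F"
  using additive_Diff[OF assms(1,3,4,5)] assms(2,3,4) Diff[of F E]
  by (fastforce simp: nonneg_on_def)

lemma (in algebra) ba_posI:
  assumes "additive M m" "nonneg_on M m"
  shows "m \<in> ba_pos M"
proof -
  have "\<bar>m F\<bar> \<le> m \<Omega>" if "F \<in> M" for F
    using additive_mono[OF assms that top sets_into_space[OF that]] assms(2) that
    by (auto simp: nonneg_on_def)
  then show ?thesis using assms by (auto simp: ba_pos_def ba_def bounded_real)
qed

lemma ba_subset: "m \<in> ba G \<Longrightarrow> H \<subseteq> G \<Longrightarrow> m \<in> ba H"
  unfolding ba_def by (auto intro: additive_subset bounded_subset)

lemma ba_add: "m \<in> ba G \<Longrightarrow> n \<in> ba G \<Longrightarrow> (\<lambda>F. m F + n F) \<in> ba G"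
  unfolding ba_def by (auto simp: additive_def intro: bounded_plus_comp)

lemma ba_cmult: "m \<in> ba G \<Longrightarrow> (\<lambda>F. c * m F) \<in> ba G"
  unfolding ba_def
  using bounded_scaling[of "m ` G" c] by (auto simp: additive_def algebra_simps image_image)

lemma ca_add: "m \<in> ca G \<Longrightarrow> n \<in> ca G \<Longrightarrow> (\<lambda>F. m F + n F) \<in> ca G"
  unfolding ca_def by (auto intro: ba_add sums_add)

lemma ca_cmult: "m \<in> ca G \<Longrightarrow> (\<lambda>F. c * m F) \<in> ca G"
  unfolding ca_def by (auto intro: ba_cmult sums_mult)

lemma ca_subset:
  assumes "m \<in> ca G" "H \<subseteq> G"
  shows "m \<in> ca H"
  using assms unfolding ca_def by (blast intro: ba_subset)

lemma (in ring_of_sets) ca_cong: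
  assumes "m \<in> ca M" "\<And>F. F \<in> M \<Longrightarrow> n F = m F"
  shows "n \<in> ca M"
proof -
  have "n \<in> ba M"
    using assms by (auto simp: ca_def ba_def additive_def bounded_real Un)
  moreover have "(\<lambda>i. n (B i)) sums n (\<Union>i. B i)"
    if "range B \<subseteq> M" "disjoint_family B" "(\<Union>i. B i) \<in> M" for B :: "nat \<Rightarrow> 'a set"
  proof -
    have "(\<lambda>i. n (B i)) = (\<lambda>i. m (B i))" using that(1) assms(2) by (auto simp: subset_eq)
    then show ?thesis using assms that unfolding ca_def by simp
  qed
  ultimately show ?thesis by (simp add: ca_def)
qed

text \<open>
  The defect \<open>m (\<Union>i. B i) - (\<Sum>i<n. m (B i))\<close> is the value of \<open>m\<close> on the remainder
  \<open>(\<Union>i. B i) - (\<Union>i<n. B i)\<close>, on which \<open>l\<close> tends to \<open>0\<close>.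
\<close>

lemma (in algebra) ca_dominated:
  fixes m l :: "'a set \<Rightarrow> real"
  assumes m: "additive M m" and l: "l \<in> ca M" and le: "\<And>F. F \<in> M \<Longrightarrow> \<bar>m F\<bar> \<le> l F"
  shows "m \<in> ca M"
proof -
  have add_l: "additive M l" using l by (simp add: ca_def ba_def)
  have "nonneg_on M l" using le by (fastforce simp: nonneg_on_def)
  then have "\<bar>m F\<bar> \<le> l \<Omega>" if "F \<in> M" for F
    using additive_mono[OF add_l _ that top sets_into_space[OF that]] le[OF that] by simp
  then have "m \<in> ba M" using m by (auto simp: ba_def bounded_real)
  moreover have "(\<lambda>i. m (B i)) sums m (\<Union>i. B i)"
    if B: "range B \<subseteq> M" "disjoint_family B" "(\<Union>i. B i) \<in> M" for B :: "nat \<Rightarrow> 'a set"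
  proof -
    let ?R = "\<lambda>n. (\<Union>i. B i) - (\<Union>i<n. B i)"
    have U: "(\<Union>i<n. B i) \<in> M" for n using B(1) by auto
    have D: "disjoint_family_on B {..<n}" for n
      using B(2) by (auto simp: disjoint_family_on_def)
    have tail: "k (?R n) = k (\<Union>i. B i) - (\<Sum>i<n. k (B i))" if "additive M k" for k :: "'a set \<Rightarrow> real" and n
    proof -
      have "k (\<Union>i<n. B i) = (\<Sum>i<n. k (B i))"
        using B(1) D by (intro additive_UN[OF that]) auto
      then show ?thesis using additive_Diff[OF that U[of n] B(3)] by auto
    qed
    have "(\<lambda>n. \<Sum>i<n. l (B i)) \<longlonglongrightarrow> l (\<Union>i. B i)"
      using l B by (auto simp: ca_def sums_def)
    then have lim: "(\<lambda>n. l (\<Union>i. B i) - (\<Sum>i<n. l (B i))) \<longlonglongrightarrow> 0"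
      using tendsto_diff[OF tendsto_const[of "l (\<Union>i. B i)"]] by fastforce
    have "norm (m (\<Union>i. B i) - (\<Sum>i<n. m (B i))) \<le> l (\<Union>i. B i) - (\<Sum>i<n. l (B i))" for n
      using le[OF Diff[OF B(3) U[of n]]] unfolding tail[OF m] tail[OF add_l] real_norm_def .
    then have "(\<lambda>n. m (\<Union>i. B i) - (\<Sum>i<n. m (B i))) \<longlonglongrightarrow> 0"
      by (intro Lim_null_comparison[OF _ lim] always_eventually allI)
    from tendsto_diff[OF tendsto_const[of "m (\<Union>i. B i)"] this]
    show ?thesis by (simp add: sums_def)
  qed
  ultimately show ?thesis by (simp add: ca_def)
qed

text \<open>
  The positive part \<open>p E\<close>, the supremum of \<open>m\<close> over the members of the algebra inside \<open>E\<close>, is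
  countably additive with \<open>m\<close>: splitting \<open>F \<subseteq> (\<Union>i. B i)\<close> along the \<open>B i\<close> gives
  \<open>m F \<le> (\<Sum>i. p (B i))\<close>. As \<open>p\<close> is nonnegative and at least \<open>m\<close>, both \<open>m\<close> and \<open>- m\<close> lie below
  \<open>2 * p - m\<close>, which is the modulus of \<open>m\<close>.
\<close>

lemma (in algebra) ca_pos_dominating:
  fixes m :: "'a set \<Rightarrow> real"
  assumes m: "m \<in> ca M"
  shows "\<exists>l\<in>ca_pos M. \<forall>F\<in>M. \<bar>m F\<bar> \<le> l F"
proof -
  define p where "p E = (SUP F\<in>{F \<in> M. F \<subseteq> E}. m F)" for E
  have add: "additive M m" and bdd: "bounded (m ` M)" using m by (auto simp: ca_def ba_def)
  obtain C where C: "\<And>F. F \<in> M \<Longrightarrow> \<bar>m F\<bar> \<le> C" using bdd by (auto simp: bounded_real)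
  have C0: "m F \<le> C" if "F \<in> M" for F using C[OF that] by linarith
  have bd: "bdd_above (m ` {F \<in> M. F \<subseteq> E})" for E
    using C0 by (auto intro!: bdd_aboveI[where M=C])
  have ge: "m F \<le> p E" if "F \<in> M" "F \<subseteq> E" for E F
    unfolding p_def using that by (intro cSUP_upper bd) auto
  have le: "p E \<le> c" if "\<And>F. F \<in> M \<Longrightarrow> F \<subseteq> E \<Longrightarrow> m F \<le> c" for E c
    unfolding p_def using that by (intro cSUP_least) auto
  have p0: "0 \<le> p E" for E using ge[of "{}" E] additive_empty[OF add] by simp
  have p_add: "additive M p"
    unfolding additive_def
  proof safe
    fix E E' assume E: "E \<in> M" "E' \<in> M" "E \<inter> E' = {}"
    show "p (E \<union> E') = p E + p E'"
    proof (rule antisym)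
      show "p (E \<union> E') \<le> p E + p E'"
      proof (rule le)
        fix F assume F: "F \<in> M" "F \<subseteq> E \<union> E'"
        have "m ((F \<inter> E) \<union> (F \<inter> E')) = m (F \<inter> E) + m (F \<inter> E')"
          using E F by (intro additiveD[OF add] Int) auto
        moreover have "(F \<inter> E) \<union> (F \<inter> E') = F" using F by blast
        moreover have "m (F \<inter> E) \<le> p E" "m (F \<inter> E') \<le> p E'" using E F by (auto intro!: ge Int)
        ultimately show "m F \<le> p E + p E'" by simp
      qed
      have "m F \<le> p (E \<union> E') - p E'" if F: "F \<in> M" "F \<subseteq> E" for F
      proof -
        have "p E' \<le> p (E \<union> E') - m F"
        proof (rule le)
          fix F' assume F': "F' \<in> M" "F' \<subseteq> E'"
          have "m (F \<union> F') = m F + m F'"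
            using F F' E by (intro additiveD[OF add]) auto
          moreover have "m (F \<union> F') \<le> p (E \<union> E')" using F F' by (intro ge) auto
          ultimately show "m F' \<le> p (E \<union> E') - m F" by simp
        qed
        then show ?thesis by simp
      qed
      then have "p E \<le> p (E \<union> E') - p E'" by (rule le)
      then show "p E + p E' \<le> p (E \<union> E')" by simp
    qed
  qed
  have p_nn: "nonneg_on M p" using p0 by (simp add: nonneg_on_def)
  have p_ba: "p \<in> ba M" using ba_posI[OF p_add p_nn] by (simp add: ba_pos_def)
  have "(\<lambda>i. p (B i)) sums p (\<Union>i. B i)"
    if B: "range B \<subseteq> M" "disjoint_family B" "(\<Union>i. B i) \<in> M" for B :: "nat \<Rightarrow> 'a set"
  proof -
    have BM: "B i \<in> M" for i using B(1) by auto
    have fin: "(\<Sum>i<n. p (B i)) \<le> p (\<Union>i. B i)" for n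
    proof -
      have "p (\<Union>i<n. B i) = (\<Sum>i<n. p (B i))"
        using B by (intro additive_UN[OF p_add]) (auto simp: disjoint_family_on_def)
      moreover have "p (\<Union>i<n. B i) \<le> p (\<Union>i. B i)"
        using BM B(3) by (intro additive_mono[OF p_add p_nn]) auto
      ultimately show ?thesis by simp
    qed
    have summ: "summable (\<lambda>i. p (B i))"
      using fin p0 by (intro summableI_nonneg_bounded) auto
    have "p (\<Union>i. B i) \<le> (\<Sum>i. p (B i))"
    proof (rule le)
      fix F assume F: "F \<in> M" "F \<subseteq> (\<Union>i. B i)"
      have eq: "(\<Union>i. F \<inter> B i) = F" using F by auto
      have "range (\<lambda>i. F \<inter> B i) \<subseteq> M" "disjoint_family (\<lambda>i. F \<inter> B i)" "(\<Union>i. F \<inter> B i) \<in> M"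
        using F(1) BM B(2) by (auto simp: eq disjoint_family_on_def simp del: UN_simps)
      then have "(\<lambda>i. m (F \<inter> B i)) sums m (\<Union>i. F \<inter> B i)"
        using m unfolding ca_def by blast
      then have "(\<lambda>i. m (F \<inter> B i)) sums m F" by (simp only: eq)
      then show "m F \<le> (\<Sum>i. p (B i))"
        by (rule sums_le[OF _ _ summable_sums[OF summ], rotated]) (use F BM in \<open>auto intro!: ge\<close>)
    qed
    moreover have "(\<Sum>i. p (B i)) \<le> p (\<Union>i. B i)"
      using fin by (intro suminf_le_const summ) auto
    ultimately have "(\<Sum>i. p (B i)) = p (\<Union>i. B i)" by (rule antisym[rotated])
    then show ?thesis using summable_sums[OF summ] by simp
  qed
  then have p_ca: "p \<in> ca M" using p_ba by (simp add: ca_def)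
  define l where "l F = 2 * p F + (- 1) * m F" for F
  have "l \<in> ca M" unfolding l_def by (intro ca_add ca_cmult p_ca m)
  moreover have abs: "\<bar>m F\<bar> \<le> l F" if "F \<in> M" for F
    using ge[OF that, of F] p0[of F] by (auto simp: l_def)
  moreover have "nonneg_on M l" unfolding nonneg_on_def
    using abs by (meson abs_ge_zero order_trans)
  ultimately show ?thesis by (auto simp: ca_pos_def)
qed

text \<open>
  The supremum in \<open>variation\<close> is only meaningful once the sums are known to be bounded. Collecting
  the cells on which \<open>m\<close> is nonnegative and those on which it is negative bounds each of them by
  twice the bound of \<open>m\<close>; then the partition of \<open>E\<close> into \<open>F\<close> and \<open>E - F\<close> gives the estimate.
\<close>

lemma (in algebra) abs_le_variation:
  fixes m :: "'a set \<Rightarrow> real"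
  assumes m: "m \<in> ba M" and EF: "E \<in> M" "F \<in> M" "F \<subseteq> E"
  shows "\<bar>m F\<bar> \<le> variation M m E"
proof -
  let ?\<P> = "{P. finite P \<and> P \<subseteq> M \<and> partition_on E P}"
  have add: "additive M m" using m by (simp add: ba_def)
  obtain C where C: "\<And>F. F \<in> M \<Longrightarrow> \<bar>m F\<bar> \<le> C" using m by (auto simp: ba_def bounded_real)
  have union: "(\<Sum>F\<in>Q. m F) = m (\<Union>Q)" if "P \<in> ?\<P>" "Q \<subseteq> P" for P Q
  proof -
    have "disjoint_family_on (\<lambda>F. F) Q"
      using that unfolding partition_on_def disjoint_def disjoint_family_on_def by blast
    moreover have "finite Q" "Q \<subseteq> M" using that by (auto intro: finite_subset)
    ultimately have "m (\<Union>F\<in>Q. F) = (\<Sum>F\<in>Q. m F)" by (intro additive_UN[OF add]) auto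
    then show ?thesis by simp
  qed
  have "(\<Sum>F\<in>P. \<bar>m F\<bar>) \<le> 2 * C" if P: "P \<in> ?\<P>" for P
  proof -
    let ?A = "{F \<in> P. 0 \<le> m F}" and ?B = "{F \<in> P. m F < 0}"
    have fin: "finite ?A" "finite ?B" using P by auto
    have "(\<Sum>F\<in>P. \<bar>m F\<bar>) = (\<Sum>F\<in>?A \<union> ?B. \<bar>m F\<bar>)" by (rule sum.cong) auto
    also have "\<dots> = (\<Sum>F\<in>?A. \<bar>m F\<bar>) + (\<Sum>F\<in>?B. \<bar>m F\<bar>)"
      using fin by (intro sum.union_disjoint) auto
    also have "\<dots> = m (\<Union>?A) - m (\<Union>?B)"
      using union[OF P, of ?A] union[OF P, of ?B] by (simp add: sum_negf)
    also have "\<dots> \<le> 2 * C"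
    proof -
      have "\<Union>?A \<in> M" "\<Union>?B \<in> M" using P fin by (auto intro!: finite_Union)
      from C[OF this(1)] C[OF this(2)] show ?thesis by linarith
    qed
    finally show ?thesis .
  qed
  then have bdd: "bdd_above ((\<lambda>P. \<Sum>F\<in>P. \<bar>m F\<bar>) ` ?\<P>)" by (auto intro!: bdd_aboveI)
  let ?P = "{F, E - F} - {{}}"
  have P: "?P \<in> ?\<P>" using EF by (auto simp: partition_on_def disjoint_def)
  have "\<bar>m F\<bar> \<le> (\<Sum>F\<in>?P. \<bar>m F\<bar>)"
  proof (cases "F = {}")
    case True
    then show ?thesis using additive_empty[OF add] by (simp add: sum_nonneg)
  next
    case False
    then show ?thesis by (intro member_le_sum) auto
  qed
  also have "\<dots> \<le> variation M m E" unfolding variation_def by (rule cSUP_upper[OF P bdd])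
  finally show ?thesis .
qed

lemma (in algebra) variation_le:
  fixes m l :: "'a set \<Rightarrow> real"
  assumes l: "additive M l" and le: "\<And>F. F \<in> M \<Longrightarrow> \<bar>m F\<bar> \<le> l F" and E: "E \<in> M"
  shows "variation M m E \<le> l E"
  unfolding variation_def
proof (rule cSUP_least)
  have "{E} - {{}} \<in> {P. finite P \<and> P \<subseteq> M \<and> partition_on E P}"
    using E by (auto simp: partition_on_def disjoint_def)
  then show "{P. finite P \<and> P \<subseteq> M \<and> partition_on E P} \<noteq> {}" by blast
next
  fix P assume P: "P \<in> {P. finite P \<and> P \<subseteq> M \<and> partition_on E P}"
  have "(\<Sum>F\<in>P. \<bar>m F\<bar>) \<le> (\<Sum>F\<in>P. l F)" using P le by (intro sum_mono) auto
  also have "\<dots> = l (\<Union>F\<in>P. F)"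
    using P by (intro additive_UN[OF l, symmetric])
      (auto simp: partition_on_def disjoint_family_on_def disjoint_def)
  also have "\<dots> = l E" using P by (simp add: partition_on_def)
  finally show "(\<Sum>F\<in>P. \<bar>m F\<bar>) \<le> l E" .
qed

section \<open>Filtrations of algebras\<close>

lemma filtration_algebra: "algebra_filtration \<Omega> A \<Longrightarrow> 0 \<le> t \<Longrightarrow> algebra \<Omega> (A t)"
  by (simp add: algebra_filtration_def)

lemma filtration_mono:
  "algebra_filtration \<Omega> A \<Longrightarrow> 0 \<le> s \<Longrightarrow> s \<le> t \<Longrightarrow> F \<in> A s \<Longrightarrow> F \<in> A t"
  unfolding algebra_filtration_def by blast

section \<open>Compactness of additive set functions\<close>

lemma compact_function_box: "compact {x :: 'b \<Rightarrow> real. \<forall>i. x i \<in> {0..c}}"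
proof -
  have "compactin (product_topology (\<lambda>i::'b. euclidean) UNIV) (PiE UNIV (\<lambda>i. {0..c::real}))"
    by (subst compactin_PiE) auto
  then have "compact (PiE UNIV (\<lambda>i::'b. {0..c::real}))"
    by (simp add: euclidean_product_topology)
  moreover have "PiE UNIV (\<lambda>i::'b. {0..c}) = {x. \<forall>i. x i \<in> {0..c}}" by auto
  ultimately show ?thesis by simp
qed

text \<open>
  Additivity, upper bounds and prescribed values each involve finitely many coordinates, so they cut
  out closed subsets of the product space \<open>{0..c} ^ (subsets of Z)\<close>, which is compact by Tychonoff's
  theorem. Infinitely many prescribed values can therefore be met as soon as finitely many can. The
  uniform bound \<open>c\<close> on the total mass is what keeps the approximations in a compact box.
\<close>

lemma additive_interpolation_compactness:
  fixes Z :: "'b set" and c :: real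
  assumes U: "\<And>B r. (B, r) \<in> U \<Longrightarrow> B \<subseteq> Z" and V: "\<And>B r. (B, r) \<in> V \<Longrightarrow> B \<subseteq> Z"
    and fin: "\<And>W. finite W \<Longrightarrow> W \<subseteq> V \<Longrightarrow>
      \<exists>x. additive (Pow Z) x \<and> nonneg_on (Pow Z) x \<and> x Z \<le> c \<and>
          (\<forall>(B, r)\<in>U. x B \<le> r) \<and> (\<forall>(B, r)\<in>W. x B = r)"
  shows "\<exists>x. additive (Pow Z) x \<and> nonneg_on (Pow Z) x \<and>
          (\<forall>(B, r)\<in>U. x B \<le> r) \<and> (\<forall>(B, r)\<in>V. x B = r)"
proof -
  define K where "K = {x :: 'b set \<Rightarrow> real. \<forall>B. x B \<in> {0..c}}"
  define Q where "Q = (\<Inter>B\<in>Pow Z. \<Inter>C\<in>{C \<in> Pow Z. B \<inter> C = {}}. {x :: 'b set \<Rightarrow> real. x (B \<union> C) = x B + x C})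
    \<inter> (\<Inter>u\<in>U. {x. x (fst u) \<le> snd u})"
  define E where "E v = {x :: 'b set \<Rightarrow> real. x (fst v) = snd v}" for v
  have Q: "x \<in> Q \<longleftrightarrow> additive (Pow Z) x \<and> (\<forall>(B, r)\<in>U. x B \<le> r)" for x
    by (auto simp: Q_def additive_def)
  have "closed Q"
    unfolding Q_def
    by (intro closed_Int closed_INT ballI closed_Collect_eq closed_Collect_le continuous_on_add
        continuous_on_product_coordinates continuous_on_const)
  then have "compact (K \<inter> Q)"
    unfolding K_def by (intro compact_Int_closed compact_function_box)
  moreover have "closed (E v)" for v
    unfolding E_def
    by (intro closed_Collect_eq continuous_on_product_coordinates continuous_on_const)
  moreover have "K \<inter> Q \<inter> (\<Inter>v\<in>W. E v) \<noteq> {}" if W: "finite W" "W \<subseteq> V" for W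
  proof -
    obtain x where x: "additive (Pow Z) x" "nonneg_on (Pow Z) x" "x Z \<le> c"
      "\<forall>(B, r)\<in>U. x B \<le> r" "\<forall>(B, r)\<in>W. x B = r"
      using fin[OF W] by blast
    interpret Z: algebra Z "Pow Z" by (rule algebra_Pow)
    \<comment> \<open>Values of \<open>x\<close> outside \<open>Pow Z\<close> are arbitrary; passing to the trace on \<open>Z\<close> puts it into the box.\<close>
    define y where "y B = x (B \<inter> Z)" for B
    have yx: "y B = x B" if "B \<subseteq> Z" for B using that by (simp add: y_def Int_absorb2)
    have "0 \<le> y B" "y B \<le> c" for B
      using x(2,3) Z.additive_mono[OF x(1,2), of "B \<inter> Z" Z] by (auto simp: y_def nonneg_on_def)
    then have "y \<in> K" by (simp add: K_def)
    moreover have "additive (Pow Z) y"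
      using x(1) yx by (simp add: additive_def)
    moreover have "y B \<le> r" if "(B, r) \<in> U" for B r
      using x(4) that yx[OF U[OF that]] by auto
    moreover have "y B = r" if "(B, r) \<in> W" for B r
      using x(5) that yx[OF V[OF subsetD[OF W(2) that]]] by auto
    ultimately have "y \<in> K \<inter> Q \<inter> (\<Inter>v\<in>W. E v)" by (auto simp: Q E_def)
    then show ?thesis by blast
  qed
  ultimately have "K \<inter> Q \<inter> (\<Inter>v\<in>V. E v) \<noteq> {}" by (rule compact_imp_fip_image)
  then obtain x where x: "x \<in> K" "x \<in> Q" "\<And>v. v \<in> V \<Longrightarrow> x \<in> E v" by blast
  have "nonneg_on (Pow Z) x" using x(1) by (auto simp: K_def nonneg_on_def)
  with x(2,3) show ?thesis by (fastforce simp: Q E_def)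
qed

section \<open>Extension from finite algebras\<close>

text \<open>
  On a finite algebra \<open>\<nu>\<close> is determined by its values on the atoms. Spreading the mass \<open>\<nu> E\<close> of each
  atom \<open>E\<close> over the subsets of \<open>E\<close> proportionally to \<open>\<rho>\<close> extends \<open>\<nu>\<close> to all subsets, and the
  extension stays below \<open>\<rho>\<close> because the density \<open>\<nu> E / \<rho> E\<close> is at most \<open>1\<close>. If \<open>\<rho> E = 0\<close> there is
  no mass to spread, and the convention \<open>\<nu> E / 0 = 0\<close> is the right one.
\<close>

lemma (in algebra) finite_algebra_extension:
  fixes \<nu> \<rho> :: "'a set \<Rightarrow> real"
  assumes fin: "finite M"
    and \<nu>: "additive M \<nu>" "nonneg_on M \<nu>"
    and \<rho>: "additive (Pow \<Omega>) \<rho>" "nonneg_on (Pow \<Omega>) \<rho>"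
    and le: "\<And>F. F \<in> M \<Longrightarrow> \<nu> F \<le> \<rho> F"
  shows "\<exists>\<kappa>. additive (Pow \<Omega>) \<kappa> \<and> nonneg_on (Pow \<Omega>) \<kappa> \<and>
    (\<forall>B\<subseteq>\<Omega>. \<kappa> B \<le> \<rho> B) \<and> (\<forall>F\<in>M. \<kappa> F = \<nu> F)"
proof -
  interpret P: algebra \<Omega> "Pow \<Omega>" by (rule algebra_Pow)
  define atom where "atom \<omega> = \<Inter>{E \<in> M. \<omega> \<in> E}" for \<omega>
  define \<A> where "\<A> = atom ` \<Omega>"
  have atom_in: "atom \<omega> \<in> M" "\<omega> \<in> atom \<omega>" if "\<omega> \<in> \<Omega>" for \<omega>
  proof -
    have "(\<Inter>E\<in>{E \<in> M. \<omega> \<in> E}. E) \<in> M"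
      using that fin by (intro finite_INT) auto
    then show "atom \<omega> \<in> M" by (simp add: atom_def)
  qed (simp add: atom_def)
  have atom_sub: "atom \<omega> \<subseteq> F" if "F \<in> M" "\<omega> \<in> F" for \<omega> F
    using that by (auto simp: atom_def)
  have atom_dich: "atom \<omega> \<subseteq> F \<or> atom \<omega> \<inter> F = {}" if "F \<in> M" "\<omega> \<in> \<Omega>" for \<omega> F
    using atom_sub[OF that(1)] atom_sub[of "\<Omega> - F" \<omega>] that by auto
  have \<A>M: "E \<in> M" if "E \<in> \<A>" for E using that atom_in by (auto simp: \<A>_def)
  have fin\<A>: "finite \<A>" using \<A>M fin by (meson finite_subset subsetI)
  have dich: "E \<subseteq> F \<or> E \<inter> F = {}" if "E \<in> \<A>" "F \<in> M" for E F
    using atom_dich that by (auto simp: \<A>_def)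
  have disj: "E \<inter> E' = {}" if "E \<in> \<A>" "E' \<in> \<A>" "E \<noteq> E'" for E E'
    using dich[OF that(1) \<A>M[OF that(2)]] dich[OF that(2) \<A>M[OF that(1)]] that(3) by blast
  have cover: "(\<Union>E\<in>\<A>. E) = \<Omega>"
    using atom_in sets_into_space by (auto simp: \<A>_def)
  have decomp: "m B = (\<Sum>E\<in>\<A>. m (B \<inter> E))"
    if "ring_of_sets \<Omega> N" "additive N m" "M \<subseteq> N" "B \<in> N" for N B and m :: "'a set \<Rightarrow> real"
  proof -
    interpret N: ring_of_sets \<Omega> N by fact
    have "m (\<Union>E\<in>\<A>. B \<inter> E) = (\<Sum>E\<in>\<A>. m (B \<inter> E))"
    proof (rule N.additive_UN[OF that(2) fin\<A>])
      show "disjoint_family_on ((\<inter>) B) \<A>" using disj unfolding disjoint_family_on_def by blast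
      show "B \<inter> E \<in> N" if "E \<in> \<A>" for E
        using \<A>M[OF that] \<open>M \<subseteq> N\<close> \<open>B \<in> N\<close> by (blast intro: N.Int)
    qed
    moreover have "(\<Union>E\<in>\<A>. B \<inter> E) = B"
      using cover N.sets_into_space[OF that(4)] by blast
    ultimately show ?thesis by simp
  qed
  have \<nu>0: "0 \<le> \<nu> E" and \<rho>0: "0 \<le> \<rho> E" if "E \<in> \<A>" for E
    using \<nu>(2) \<rho>(2) \<A>M[OF that] sets_into_space by (auto simp: nonneg_on_def)
  define \<kappa> where "\<kappa> B = (\<Sum>E\<in>\<A>. \<nu> E / \<rho> E * \<rho> (B \<inter> E))" for B
  have "additive (Pow \<Omega>) \<kappa>"
    unfolding additive_def
  proof safe
    fix B C assume BC: "B \<subseteq> \<Omega>" "C \<subseteq> \<Omega>" "B \<inter> C = {}"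
    have "\<rho> ((B \<union> C) \<inter> E) = \<rho> (B \<inter> E) + \<rho> (C \<inter> E)" for E
      using additiveD[OF \<rho>(1), of "B \<inter> E" "C \<inter> E"] BC by (auto simp: Int_Un_distrib2)
    then show "\<kappa> (B \<union> C) = \<kappa> B + \<kappa> C"
      by (simp add: \<kappa>_def distrib_left sum.distrib)
  qed
  moreover have "nonneg_on (Pow \<Omega>) \<kappa>"
    using \<nu>0 \<rho>0 \<rho>(2) unfolding nonneg_on_def \<kappa>_def
    by (auto intro!: sum_nonneg mult_nonneg_nonneg divide_nonneg_nonneg)
  moreover have "\<kappa> B \<le> \<rho> B" if B: "B \<subseteq> \<Omega>" for B
  proof -
    have "\<kappa> B \<le> (\<Sum>E\<in>\<A>. \<rho> (B \<inter> E))"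
      unfolding \<kappa>_def
    proof (rule sum_mono)
      fix E assume E: "E \<in> \<A>"
      have "\<nu> E / \<rho> E \<le> 1" using le[OF \<A>M[OF E]] \<rho>0[OF E] by (auto simp: divide_le_eq_1)
      moreover have "0 \<le> \<rho> (B \<inter> E)" using \<rho>(2) B by (auto simp: nonneg_on_def)
      ultimately show "\<nu> E / \<rho> E * \<rho> (B \<inter> E) \<le> \<rho> (B \<inter> E)"
        using mult_right_mono by fastforce
    qed
    also have "\<dots> = \<rho> B"
      using decomp[OF P.ring_of_sets_axioms \<rho>(1), of B] B space_closed by simp
    finally show ?thesis .
  qed
  moreover have "\<kappa> F = \<nu> F" if F: "F \<in> M" for F
  proof -
    have "\<kappa> F = (\<Sum>E\<in>\<A>. \<nu> (F \<inter> E))"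
      unfolding \<kappa>_def
    proof (rule sum.cong[OF refl])
      fix E assume E: "E \<in> \<A>"
      consider "F \<inter> E = E" | "F \<inter> E = {}" using dich[OF E F] by blast
      then show "\<nu> E / \<rho> E * \<rho> (F \<inter> E) = \<nu> (F \<inter> E)"
      proof cases
        case 1
        have "\<nu> E = 0" if "\<rho> E = 0" using le[OF \<A>M[OF E]] \<nu>0[OF E] that by simp
        with 1 show ?thesis by simp
      next
        case 2
        then show ?thesis using additive_empty[OF \<nu>(1)] additive_empty[OF \<rho>(1)] by simp
      qed
    qed
    also have "\<dots> = \<nu> F"
      using decomp[OF ring_of_sets_axioms \<nu>(1) _ F] by simp
    finally show ?thesis .
  qed
  ultimately show ?thesis by blast
qed

text \<open>
  The algebra generated by \<open>S\<close>, encoded so that its finiteness is evident: its members are the sets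
  for which membership of a point depends only on which elements of \<open>S\<close> contain that point.
\<close>

definition generated_algebra :: "'a set \<Rightarrow> 'a set set \<Rightarrow> 'a set set" where
  "generated_algebra \<Omega> S = (\<lambda>T. {\<omega>\<in>\<Omega>. {F\<in>S. \<omega> \<in> F} \<in> T}) ` Pow (Pow S)"

lemma generated_algebra_properties:
  assumes "finite S" "S \<subseteq> Pow \<Omega>"
  shows "algebra \<Omega> (generated_algebra \<Omega> S)" "finite (generated_algebra \<Omega> S)" "S \<subseteq> generated_algebra \<Omega> S"
proof -
  let ?g = "\<lambda>T. {\<omega>\<in>\<Omega>. {F\<in>S. \<omega> \<in> F} \<in> T}"
  show "finite (generated_algebra \<Omega> S)" using assms(1) by (simp add: generated_algebra_def)
  show "S \<subseteq> generated_algebra \<Omega> S"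
  proof
    fix F assume F: "F \<in> S"
    then have "F = ?g {T \<in> Pow S. F \<in> T}" using assms(2) by auto
    then show "F \<in> generated_algebra \<Omega> S" unfolding generated_algebra_def by blast
  qed
  show "algebra \<Omega> (generated_algebra \<Omega> S)"
    unfolding algebra_iff_Un
  proof (intro conjI ballI)
    show "generated_algebra \<Omega> S \<subseteq> Pow \<Omega>" by (auto simp: generated_algebra_def)
    have "{} = ?g {}" by auto
    then show "{} \<in> generated_algebra \<Omega> S" unfolding generated_algebra_def by blast
    fix a assume "a \<in> generated_algebra \<Omega> S"
    then obtain T where T: "T \<subseteq> Pow S" "a = ?g T" by (auto simp: generated_algebra_def)
    have "\<Omega> - a = ?g (Pow S - T)" using T by auto
    then show "\<Omega> - a \<in> generated_algebra \<Omega> S" unfolding generated_algebra_def by blast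
    fix b assume "b \<in> generated_algebra \<Omega> S"
    then obtain T' where T': "T' \<subseteq> Pow S" "b = ?g T'" by (auto simp: generated_algebra_def)
    have "a \<union> b = ?g (T \<union> T')" using T T' by auto
    moreover have "T \<union> T' \<in> Pow (Pow S)" using T T' by auto
    ultimately show "a \<union> b \<in> generated_algebra \<Omega> S" unfolding generated_algebra_def by blast
  qed
qed

lemma algebra_Int:
  assumes "algebra \<Omega> G" "algebra \<Omega> H"
  shows "algebra \<Omega> (G \<inter> H)"
proof -
  interpret G: algebra \<Omega> G by fact
  interpret H: algebra \<Omega> H by fact
  show ?thesis unfolding algebra_iff_Un using G.space_closed by auto
qed

section \<open>Set functions on the product with the time axis\<close>

text \<open>
  Times are added from the latest to the earliest. To match \<open>\<pi> b\<close> at a time \<open>b\<close> before all those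
  in \<open>D\<close>, \<open>x\<close> must gain the mass \<open>\<nu> F = \<pi> b F - x (F \<times> {0..})\<close> for \<open>F \<in> G b\<close>, and it may use at
  most what remains of \<open>\<rho>\<close> after subtracting the time marginal of \<open>x\<close>. An extension \<open>\<kappa>\<close> of \<open>\<nu>\<close>
  below this remainder is placed on the slice of a single time \<open>c > b\<close> not beyond the first time in
  \<open>D\<close>, so that the tails at the times in \<open>D\<close> do not change.

  The last conjunct carries the induction: \<open>x\<close> has no mass up to the first time in \<open>D\<close>, and the
  missing mass at any \<open>b\<close> up to then is nonnegative, which persists because \<open>\<pi>\<close> decreases in time.
  With \<open>b = 0\<close> it also bounds the total mass.
\<close>

lemma finite_times_interpolation:
  fixes G :: "real \<Rightarrow> 'a set set" and \<pi> :: "real \<Rightarrow> 'a set \<Rightarrow> real" and \<rho> :: "'a set \<Rightarrow> real"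
  assumes D: "finite D" "D \<subseteq> {0..}"
    and G: "algebra_filtration \<Omega> G" "\<And>t. t \<ge> 0 \<Longrightarrow> finite (G t)"
    and \<pi>: "\<And>t. t \<ge> 0 \<Longrightarrow> additive (G t) (\<pi> t)" "\<And>t. t \<ge> 0 \<Longrightarrow> nonneg_on (G t) (\<pi> t)"
      "\<And>s t F. 0 \<le> s \<Longrightarrow> s \<le> t \<Longrightarrow> F \<in> G s \<Longrightarrow> \<pi> t F \<le> \<pi> s F"
    and \<rho>: "additive (Pow \<Omega>) \<rho>" "nonneg_on (Pow \<Omega>) \<rho>"
    and le: "\<And>t F. t \<ge> 0 \<Longrightarrow> F \<in> G t \<Longrightarrow> \<pi> t F \<le> \<rho> F"
  shows "\<exists>x. additive (Pow (time_product \<Omega>)) x \<and> nonneg_on (Pow (time_product \<Omega>)) x \<and>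
    (\<forall>t\<in>D. \<forall>F\<in>G t. x (F \<times> {t<..}) = \<pi> t F) \<and>
    (\<forall>B\<subseteq>\<Omega>. x (B \<times> {0..}) \<le> \<rho> B) \<and>
    (\<forall>b\<ge>0. (\<forall>a\<in>D. b \<le> a) \<longrightarrow>
      (\<forall>B\<subseteq>\<Omega>. x (B \<times> {b<..}) = x (B \<times> {0..})) \<and> (\<forall>F\<in>G b. x (F \<times> {0..}) \<le> \<pi> b F))"
  using D
proof (induction D rule: finite_linorder_min_induct)
  case empty
  show ?case
    using \<pi>(2) \<rho>(2)
    by (intro exI[of _ "\<lambda>_. 0"]) (auto simp: additive_def nonneg_on_def)
next
  case (insert b D)
  let ?Z = "time_product \<Omega>"
  from insert obtain x where x: "additive (Pow ?Z) x" "nonneg_on (Pow ?Z) x"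
    and x_t: "\<And>t F. t \<in> D \<Longrightarrow> F \<in> G t \<Longrightarrow> x (F \<times> {t<..}) = \<pi> t F"
    and x_le: "\<And>B. B \<subseteq> \<Omega> \<Longrightarrow> x (B \<times> {0..}) \<le> \<rho> B"
    and x_late: "\<And>b B. b \<ge> 0 \<Longrightarrow> \<forall>a\<in>D. b \<le> a \<Longrightarrow> B \<subseteq> \<Omega> \<Longrightarrow> x (B \<times> {b<..}) = x (B \<times> {0..})"
    and x_\<pi>: "\<And>b F. b \<ge> 0 \<Longrightarrow> \<forall>a\<in>D. b \<le> a \<Longrightarrow> F \<in> G b \<Longrightarrow> x (F \<times> {0..}) \<le> \<pi> b F"
    by auto
  have b: "0 \<le> b" "\<forall>a\<in>D. b \<le> a" using insert by force+
  interpret Gb: algebra \<Omega> "G b" using filtration_algebra[OF G(1) b(1)] .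
  have G_space: "F \<subseteq> \<Omega>" if "t \<ge> 0" "F \<in> G t" for t F
    using algebra.axioms(1)[OF filtration_algebra[OF G(1) that(1)], THEN ring_of_sets_iff[THEN iffD1]]
      that(2) by blast
  have x_marg: "x ((B \<union> C) \<times> {0..}) = x (B \<times> {0..}) + x (C \<times> {0..})"
    if "B \<subseteq> \<Omega>" "C \<subseteq> \<Omega>" "B \<inter> C = {}" for B C
    using additiveD[OF x(1), of "B \<times> {0..}" "C \<times> {0..}"] that
    by (auto simp: time_product_def Sigma_Un_distrib1)
  have \<nu>_add: "additive (G b) (\<lambda>F. \<pi> b F - x (F \<times> {0..}))"
    using \<pi>(1)[OF b(1)] x_marg Gb.sets_into_space by (auto simp: additive_def)
  have \<nu>_nn: "nonneg_on (G b) (\<lambda>F. \<pi> b F - x (F \<times> {0..}))"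
    using x_\<pi>[OF b] by (auto simp: nonneg_on_def)
  have \<rho>_add: "additive (Pow \<Omega>) (\<lambda>B. \<rho> B - x (B \<times> {0..}))"
    using \<rho>(1) x_marg by (auto simp: additive_def)
  have \<rho>_nn: "nonneg_on (Pow \<Omega>) (\<lambda>B. \<rho> B - x (B \<times> {0..}))"
    using x_le by (auto simp: nonneg_on_def)
  have \<nu>_le: "\<pi> b F - x (F \<times> {0..}) \<le> \<rho> F - x (F \<times> {0..})" if "F \<in> G b" for F
    using le[OF b(1) that] by simp
  obtain \<kappa> where \<kappa>: "additive (Pow \<Omega>) \<kappa>" "nonneg_on (Pow \<Omega>) \<kappa>"
    "\<forall>B\<subseteq>\<Omega>. \<kappa> B \<le> \<rho> B - x (B \<times> {0..})"
    "\<forall>F\<in>G b. \<kappa> F = \<pi> b F - x (F \<times> {0..})"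
    by (rule exE[OF Gb.finite_algebra_extension[OF G(2)[OF b(1)] \<nu>_add \<nu>_nn \<rho>_add \<rho>_nn \<nu>_le]])
      (assumption, elim conjE, rule that)
  \<comment> \<open>The element \<open>b + 1\<close> makes \<open>c\<close> meaningful when \<open>D\<close> is empty.\<close>
  define c where "c = Min (insert (b + 1) D)"
  have c: "b < c" "\<And>a. a \<in> D \<Longrightarrow> c \<le> a" using insert by (auto simp: c_def)
  define y where "y B = x B + \<kappa> {\<omega>. (\<omega>, c) \<in> B}" for B
  have slice: "{\<omega>. (\<omega>, c) \<in> B} \<subseteq> \<Omega>" if "B \<subseteq> ?Z" for B using that by (auto simp: time_product_def)
  have y_in: "y (B \<times> T) = x (B \<times> T) + \<kappa> B" if "c \<in> T" for B T
    using that by (simp add: y_def)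
  have y_out: "y (B \<times> T) = x (B \<times> T)" if "c \<notin> T" for B T
    using that additive_empty[OF \<kappa>(1)] by (simp add: y_def)
  have y_add: "additive (Pow ?Z) y"
    unfolding additive_def
  proof safe
    fix B C assume BC: "B \<subseteq> ?Z" "C \<subseteq> ?Z" "B \<inter> C = {}"
    have "x (B \<union> C) = x B + x C" using BC by (intro additiveD[OF x(1)]) auto
    moreover have "\<kappa> ({\<omega>. (\<omega>, c) \<in> B} \<union> {\<omega>. (\<omega>, c) \<in> C}) = \<kappa> {\<omega>. (\<omega>, c) \<in> B} + \<kappa> {\<omega>. (\<omega>, c) \<in> C}"
      using BC slice by (intro additiveD[OF \<kappa>(1)]) auto
    moreover have "{\<omega>. (\<omega>, c) \<in> B} \<union> {\<omega>. (\<omega>, c) \<in> C} = {\<omega>. (\<omega>, c) \<in> B \<union> C}" by auto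
    ultimately show "y (B \<union> C) = y B + y C" by (simp add: y_def)
  qed
  have y_nn: "nonneg_on (Pow ?Z) y"
    using x(2) \<kappa>(2) slice unfolding nonneg_on_def y_def by (auto intro!: add_nonneg_nonneg)
  have y_t: "y (F \<times> {t<..}) = \<pi> t F" if "t \<in> insert b D" "F \<in> G t" for t F
  proof (cases "t = b")
    case True
    then show ?thesis
      using that \<kappa>(4) c(1) x_late[OF b, of F] G_space[OF b(1), of F] by (simp add: y_in)
  next
    case False
    then show ?thesis using that c(2)[of t] x_t[of t F] by (simp add: y_out)
  qed
  have y0: "y (B \<times> {0..}) = x (B \<times> {0..}) + \<kappa> B" for B
    using b(1) c(1) by (simp add: y_in)
  have y_le: "y (B \<times> {0..}) \<le> \<rho> B" if "B \<subseteq> \<Omega>" for B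
    using y0[of B] \<kappa>(3)[rule_format, OF that] by simp
  have y_late: "y (B \<times> {b'<..}) = y (B \<times> {0..})" if "b' \<ge> 0" "\<forall>a\<in>insert b D. b' \<le> a" "B \<subseteq> \<Omega>" for b' B
    using x_late[OF that(1) _ that(3)] that(2) c(1) y0 by (simp add: y_in)
  have y_\<pi>: "y (F \<times> {0..}) \<le> \<pi> b' F" if "b' \<ge> 0" "\<forall>a\<in>insert b D. b' \<le> a" "F \<in> G b'" for b' F
  proof -
    have "F \<in> G b" using filtration_mono[OF G(1) that(1) _ that(3), of b] that(2) by simp
    then show ?thesis using y0 \<kappa>(4) \<pi>(3)[of b' b F] that by simp
  qed
  show ?case
    by (intro exI[of _ y] conjI ballI allI impI y_add y_nn) (fact y_t y_le y_late y_\<pi>)+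
qed

text \<open>
  Compactness reduces the claim to finitely many pairs of a time \<open>t\<close> and a set \<open>F \<in> A t\<close>, hence to
  finitely many times and to the finite algebras \<open>A t \<inter> generated_algebra \<Omega> S\<close>, where \<open>S\<close> collects
  the sets. The dominating \<open>\<rho>\<close> may depend on \<open>S\<close>; only the bounds listed in \<open>U\<close> have to be uniform.
\<close>

lemma potential_representation:
  fixes A :: "real \<Rightarrow> 'a set set" and \<pi> :: "real \<Rightarrow> 'a set \<Rightarrow> real" and U :: "('a set \<times> real) set"
  assumes A: "algebra_filtration \<Omega> A"
    and \<pi>: "\<And>t. t \<ge> 0 \<Longrightarrow> additive (A t) (\<pi> t)" "\<And>t. t \<ge> 0 \<Longrightarrow> nonneg_on (A t) (\<pi> t)"
      "\<And>s t F. 0 \<le> s \<Longrightarrow> s \<le> t \<Longrightarrow> F \<in> A s \<Longrightarrow> \<pi> t F \<le> \<pi> s F"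
    and U: "\<And>B r. (B, r) \<in> U \<Longrightarrow> B \<subseteq> \<Omega>"
    and dom: "\<And>S. finite S \<Longrightarrow> S \<subseteq> Pow \<Omega> \<Longrightarrow> \<exists>\<rho>. additive (Pow \<Omega>) \<rho> \<and> nonneg_on (Pow \<Omega>) \<rho> \<and>
      (\<forall>t\<ge>0. \<forall>F\<in>A t \<inter> generated_algebra \<Omega> S. \<pi> t F \<le> \<rho> F) \<and> (\<forall>(B, r)\<in>U. \<rho> B \<le> r)"
  shows "\<exists>x. additive (Pow (time_product \<Omega>)) x \<and> nonneg_on (Pow (time_product \<Omega>)) x \<and>
    (\<forall>(B, r)\<in>U. x (B \<times> {0..}) \<le> r) \<and> (\<forall>t\<ge>0. \<forall>F\<in>A t. x (F \<times> {t<..}) = \<pi> t F)"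
proof -
  let ?Z = "time_product \<Omega>"
  define U' where "U' = (\<lambda>(B, r). (B \<times> {0::real..}, r)) ` U"
  define v where "v = (\<lambda>(t, F). (F \<times> {t<..}, \<pi> t F))"
  define V where "V = v ` (SIGMA t:{0..}. A t)"
  have A_space: "F \<subseteq> \<Omega>" if "0 \<le> t" "F \<in> A t" for t F
  proof -
    interpret algebra \<Omega> "A t" by (rule filtration_algebra[OF A that(1)])
    show ?thesis using that(2) by (rule sets_into_space)
  qed
  have "\<exists>x. additive (Pow ?Z) x \<and> nonneg_on (Pow ?Z) x \<and>
      (\<forall>(B, r)\<in>U'. x B \<le> r) \<and> (\<forall>(B, r)\<in>V. x B = r)"
  proof (rule additive_interpolation_compactness[where c = "\<pi> 0 \<Omega>"])
    show "B \<subseteq> ?Z" if "(B, r) \<in> U'" for B r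
      using that U by (fastforce simp: U'_def time_product_def)
    show "B \<subseteq> ?Z" if "(B, r) \<in> V" for B r
      using that A_space by (fastforce simp: V_def v_def time_product_def)
  next
    fix W assume W: "finite W" "W \<subseteq> V"
    then obtain K where K: "finite K" "K \<subseteq> (SIGMA t:{0..}. A t)" "W = v ` K"
      unfolding V_def by (meson finite_subset_image)
    define S where "S = snd ` K"
    define G where "G t = A t \<inter> generated_algebra \<Omega> S" for t
    have S: "finite S" using K(1) by (simp add: S_def)
    have S_space: "S \<subseteq> Pow \<Omega>" using K(2) A_space by (fastforce simp: S_def)
    have G: "algebra_filtration \<Omega> G"
      using generated_algebra_properties(1)[OF S S_space] filtration_algebra[OF A] filtration_mono[OF A]
      unfolding algebra_filtration_def G_def by (auto intro: algebra_Int)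
    obtain \<rho> where \<rho>: "additive (Pow \<Omega>) \<rho>" "nonneg_on (Pow \<Omega>) \<rho>"
      "\<forall>t\<ge>0. \<forall>F\<in>G t. \<pi> t F \<le> \<rho> F" "\<forall>(B, r)\<in>U. \<rho> B \<le> r"
      using dom[OF S S_space] unfolding G_def by (elim exE conjE)
    have "\<exists>x. additive (Pow ?Z) x \<and> nonneg_on (Pow ?Z) x \<and>
      (\<forall>t\<in>fst ` K. \<forall>F\<in>G t. x (F \<times> {t<..}) = \<pi> t F) \<and>
      (\<forall>B\<subseteq>\<Omega>. x (B \<times> {0..}) \<le> \<rho> B) \<and>
      (\<forall>b\<ge>0. (\<forall>a\<in>fst ` K. b \<le> a) \<longrightarrow>
        (\<forall>B\<subseteq>\<Omega>. x (B \<times> {b<..}) = x (B \<times> {0..})) \<and> (\<forall>F\<in>G b. x (F \<times> {0..}) \<le> \<pi> b F))"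
    proof (rule finite_times_interpolation[OF _ _ G _ _ _ _ \<rho>(1,2)])
      show "finite (G t)" for t using generated_algebra_properties(2)[OF S S_space] by (simp add: G_def)
      show "additive (G t) (\<pi> t)" if "0 \<le> t" for t
        using \<pi>(1)[OF that] by (rule additive_subset) (simp add: G_def)
      show "nonneg_on (G t) (\<pi> t)" if "0 \<le> t" for t
        using \<pi>(2)[OF that] by (simp add: nonneg_on_def G_def)
    qed (use K \<pi>(3) \<rho>(3) in \<open>auto simp: G_def\<close>)
    then obtain x where x: "additive (Pow ?Z) x" "nonneg_on (Pow ?Z) x"
      and x_t: "\<forall>t\<in>fst ` K. \<forall>F\<in>G t. x (F \<times> {t<..}) = \<pi> t F"
      and x_le: "\<forall>B\<subseteq>\<Omega>. x (B \<times> {0..}) \<le> \<rho> B"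
      and x_0: "\<forall>b\<ge>0. (\<forall>a\<in>fst ` K. b \<le> a) \<longrightarrow>
        (\<forall>B\<subseteq>\<Omega>. x (B \<times> {b<..}) = x (B \<times> {0..})) \<and> (\<forall>F\<in>G b. x (F \<times> {0..}) \<le> \<pi> b F)"
      by (elim exE conjE)
    have "x ?Z \<le> \<pi> 0 \<Omega>"
    proof -
      interpret G0: algebra \<Omega> "G 0" by (rule filtration_algebra[OF G order_refl])
      have "\<forall>a\<in>fst ` K. 0 \<le> a" using K by auto
      then show ?thesis using x_0[rule_format, of 0] by (auto simp: time_product_def)
    qed
    moreover have "x B \<le> r" if Br: "(B, r) \<in> U'" for B r
    proof -
      obtain C where C: "(C, r) \<in> U" "B = C \<times> {0..}" using Br by (auto simp: U'_def)
      have "x B \<le> \<rho> C" using x_le[rule_format, OF U[OF C(1)]] C(2) by simp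
      moreover have "\<rho> C \<le> r" using \<rho>(4) C(1) by auto
      ultimately show ?thesis by simp
    qed
    moreover have "x B = r" if Br: "(B, r) \<in> W" for B r
    proof -
      obtain t F where tF: "(t, F) \<in> K" "B = F \<times> {t<..}" "r = \<pi> t F"
        using Br by (auto simp: K(3) v_def)
      have "F \<in> S" using tF(1) by (force simp: S_def)
      then have "F \<in> G t" using tF(1) K(2) generated_algebra_properties(3)[OF S S_space] by (auto simp: G_def)
      moreover have "t \<in> fst ` K" using tF(1) by force
      ultimately show ?thesis using x_t[rule_format, of t F] tF(2,3) by simp
    qed
    ultimately show "\<exists>x. additive (Pow ?Z) x \<and> nonneg_on (Pow ?Z) x \<and> x ?Z \<le> \<pi> 0 \<Omega> \<and>
        (\<forall>(B, r)\<in>U'. x B \<le> r) \<and> (\<forall>(B, r)\<in>W. x B = r)"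
      using x by (intro exI[of _ x]) auto
  qed
  then obtain x where x: "additive (Pow ?Z) x" "nonneg_on (Pow ?Z) x"
    "\<forall>(B, r)\<in>U'. x B \<le> r" "\<forall>(B, r)\<in>V. x B = r"
    by (elim exE conjE)
  have "\<forall>(B, r)\<in>U. x (B \<times> {0..}) \<le> r" using x(3) by (auto simp: U'_def)
  moreover have "\<forall>t\<ge>0. \<forall>F\<in>A t. x (F \<times> {t<..}) = \<pi> t F" using x(4) by (auto simp: V_def v_def)
  ultimately show ?thesis using x(1,2) by blast
qed

text \<open>
  Each finite algebra has its own dominating set function: the counting measure on a finite set \<open>P\<close>
  of points that meets every nonempty member, multiplied by the largest value \<open>\<pi> 0 \<Omega>\<close>.
\<close>

lemma potential_representation_unconstrained:
  fixes A :: "real \<Rightarrow> 'a set set" and \<pi> :: "real \<Rightarrow> 'a set \<Rightarrow> real"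
  assumes A: "algebra_filtration \<Omega> A"
    and \<pi>: "\<And>t. t \<ge> 0 \<Longrightarrow> additive (A t) (\<pi> t)" "\<And>t. t \<ge> 0 \<Longrightarrow> nonneg_on (A t) (\<pi> t)"
      "\<And>s t F. 0 \<le> s \<Longrightarrow> s \<le> t \<Longrightarrow> F \<in> A s \<Longrightarrow> \<pi> t F \<le> \<pi> s F"
  shows "\<exists>x. additive (Pow (time_product \<Omega>)) x \<and> nonneg_on (Pow (time_product \<Omega>)) x \<and>
    (\<forall>t\<ge>0. \<forall>F\<in>A t. x (F \<times> {t<..}) = \<pi> t F)"
proof -
  have "\<exists>x. additive (Pow (time_product \<Omega>)) x \<and> nonneg_on (Pow (time_product \<Omega>)) x \<and>
    (\<forall>(B, r)\<in>{}. x (B \<times> {0..}) \<le> r) \<and> (\<forall>t\<ge>0. \<forall>F\<in>A t. x (F \<times> {t<..}) = \<pi> t F)"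
  proof (rule potential_representation[OF A \<pi>])
    fix S assume S: "finite S" "S \<subseteq> Pow \<Omega>"
    define P where "P = (\<lambda>E. SOME \<omega>. \<omega> \<in> E) ` (generated_algebra \<Omega> S - {{}})"
    have P: "finite P" using generated_algebra_properties(2)[OF S] by (simp add: P_def)
    have meets: "E \<inter> P \<noteq> {}" if "E \<in> generated_algebra \<Omega> S" "E \<noteq> {}" for E
      using that some_in_eq[of E] by (auto simp: P_def)
    define \<rho> where "\<rho> B = \<pi> 0 \<Omega> * real (card (B \<inter> P))" for B
    have \<Omega>0: "\<Omega> \<in> A 0" using algebra.top[OF filtration_algebra[OF A order_refl]] .
    have M: "0 \<le> \<pi> 0 \<Omega>" using \<pi>(2)[OF order_refl] \<Omega>0 by (simp add: nonneg_on_def)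
    have "additive (Pow \<Omega>) \<rho>"
      unfolding additive_def
    proof safe
      fix B C :: "'a set" assume "B \<inter> C = {}"
      then have "card ((B \<union> C) \<inter> P) = card (B \<inter> P) + card (C \<inter> P)"
        using P by (subst Int_Un_distrib2, intro card_Un_disjoint) auto
      then show "\<rho> (B \<union> C) = \<rho> B + \<rho> C" by (simp add: \<rho>_def algebra_simps)
    qed
    moreover have "nonneg_on (Pow \<Omega>) \<rho>" using M by (simp add: nonneg_on_def \<rho>_def)
    moreover have "\<pi> t F \<le> \<rho> F" if t: "0 \<le> t" and F: "F \<in> A t \<inter> generated_algebra \<Omega> S" for t F
    proof (cases "F = {}")
      case True
      then show ?thesis using additive_empty[OF \<pi>(1)[OF t]] F by (simp add: \<rho>_def)
    next
      case False
      interpret algebra \<Omega> "A t" by (rule filtration_algebra[OF A t])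
      have "\<pi> t F \<le> \<pi> t \<Omega>"
        using F sets_into_space by (intro additive_mono[OF \<pi>(1)[OF t] \<pi>(2)[OF t]]) auto
      also have "\<dots> \<le> \<pi> 0 \<Omega> * 1" using \<pi>(3)[OF _ t \<Omega>0] by simp
      also have "\<dots> \<le> \<rho> F"
        unfolding \<rho>_def using M meets[OF _ False] F P
        by (intro mult_left_mono) (auto simp: Suc_le_eq card_gt_0_iff)
      finally show ?thesis .
    qed
    ultimately show "\<exists>\<rho>. additive (Pow \<Omega>) \<rho> \<and> nonneg_on (Pow \<Omega>) \<rho> \<and>
      (\<forall>t\<ge>0. \<forall>F\<in>A t \<inter> generated_algebra \<Omega> S. \<pi> t F \<le> \<rho> F) \<and> (\<forall>(B, r)\<in>{}. \<rho> B \<le> r)"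
      by blast
  qed auto
  then show ?thesis by simp
qed

lemma slice_additive:
  assumes "additive (Pow (time_product \<Omega>)) x" "T \<subseteq> {0..}"
  shows "additive (Pow \<Omega>) (\<lambda>B. x (B \<times> T))"
  unfolding additive_def
proof safe
  fix B C assume "B \<subseteq> \<Omega>" "C \<subseteq> \<Omega>" "B \<inter> C = {}"
  then show "x ((B \<union> C) \<times> T) = x (B \<times> T) + x (C \<times> T)"
    using additiveD[OF assms(1), of "B \<times> T" "C \<times> T"] assms(2)
    by (auto simp: Sigma_Un_distrib1 time_product_def)
qed

lemma slice_nonneg:
  assumes "nonneg_on (Pow (time_product \<Omega>)) x" "T \<subseteq> {0..}"
  shows "nonneg_on (Pow \<Omega>) (\<lambda>B. x (B \<times> T))"
  using assms by (auto simp: nonneg_on_def time_product_def)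

text \<open>
  Apply the representation to the constant filtration and the potential that equals \<open>l\<close> before
  time \<open>1\<close> and vanishes from then on; the mass after time \<open>0\<close> is an extension of \<open>l\<close>.
\<close>

lemma (in algebra) positive_extension:
  assumes l: "additive M l" "nonneg_on M l"
  shows "\<exists>\<rho>::'a set \<Rightarrow> real. additive (Pow \<Omega>) \<rho> \<and> nonneg_on (Pow \<Omega>) \<rho> \<and> (\<forall>F\<in>M. \<rho> F = l F)"
proof -
  have "\<exists>x. additive (Pow (time_product \<Omega>)) x \<and> nonneg_on (Pow (time_product \<Omega>)) x \<and>
    (\<forall>t\<ge>0. \<forall>F\<in>M. x (F \<times> {t<..}) = (if t < 1 then l F else 0))"
    using l algebra_axioms
    by (intro potential_representation_unconstrained)
      (auto simp: algebra_filtration_def additive_def nonneg_on_def)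
  then obtain x where x: "additive (Pow (time_product \<Omega>)) x" "nonneg_on (Pow (time_product \<Omega>)) x"
    "\<forall>t\<ge>0. \<forall>F\<in>M. x (F \<times> {t<..}) = (if t < 1 then l F else 0)"
    by (elim exE conjE)
  have "{0<..} \<subseteq> {0::real..}" by auto
  then show ?thesis
    using slice_additive[OF x(1), of "{0<..}"] slice_nonneg[OF x(2), of "{0<..}"] x(3)
    by (intro exI[of _ "\<lambda>B. x (B \<times> {0<..})"]) auto
qed

lemma potential_representation_dominated:
  fixes A :: "real \<Rightarrow> 'a set set" and \<pi> :: "real \<Rightarrow> 'a set \<Rightarrow> real"
  assumes A: "algebra_filtration \<Omega> A"
    and \<pi>: "\<And>t. t \<ge> 0 \<Longrightarrow> additive (A t) (\<pi> t)" "\<And>t. t \<ge> 0 \<Longrightarrow> nonneg_on (A t) (\<pi> t)"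
      "\<And>s t F. 0 \<le> s \<Longrightarrow> s \<le> t \<Longrightarrow> F \<in> A s \<Longrightarrow> \<pi> t F \<le> \<pi> s F"
    and \<rho>: "additive (Pow \<Omega>) \<rho>" "nonneg_on (Pow \<Omega>) \<rho>"
    and le: "\<And>t F. t \<ge> 0 \<Longrightarrow> F \<in> A t \<Longrightarrow> \<pi> t F \<le> \<rho> F"
  shows "\<exists>x. additive (Pow (time_product \<Omega>)) x \<and> nonneg_on (Pow (time_product \<Omega>)) x \<and>
    (\<forall>B\<subseteq>\<Omega>. x (B \<times> {0..}) \<le> \<rho> B) \<and> (\<forall>t\<ge>0. \<forall>F\<in>A t. x (F \<times> {t<..}) = \<pi> t F)"
proof -
  let ?U = "(\<lambda>B. (B, \<rho> B)) ` Pow \<Omega>"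
  have "\<exists>x. additive (Pow (time_product \<Omega>)) x \<and> nonneg_on (Pow (time_product \<Omega>)) x \<and>
    (\<forall>(B, r)\<in>?U. x (B \<times> {0..}) \<le> r) \<and> (\<forall>t\<ge>0. \<forall>F\<in>A t. x (F \<times> {t<..}) = \<pi> t F)"
  proof (rule potential_representation[OF A \<pi>])
    show "\<exists>\<rho>. additive (Pow \<Omega>) \<rho> \<and> nonneg_on (Pow \<Omega>) \<rho> \<and>
      (\<forall>t\<ge>0. \<forall>F\<in>A t \<inter> generated_algebra \<Omega> S. \<pi> t F \<le> \<rho> F) \<and> (\<forall>(B, r)\<in>?U. \<rho> B \<le> r)" for S
      using \<rho> le by (intro exI[of _ \<rho>]) auto
  qed auto
  then obtain x where x: "additive (Pow (time_product \<Omega>)) x" "nonneg_on (Pow (time_product \<Omega>)) x"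
    "\<forall>(B, r)\<in>?U. x (B \<times> {0..}) \<le> r" "\<forall>t\<ge>0. \<forall>F\<in>A t. x (F \<times> {t<..}) = \<pi> t F"
    by (elim exE conjE)
  have "\<forall>B\<subseteq>\<Omega>. x (B \<times> {0..}) \<le> \<rho> B" using x(3) by auto
  then show ?thesis using x(1,2,4) by (intro exI[of _ x] conjI)
qed

text \<open>
  This is Caratheodory's extension theorem, transferred between real and extended nonnegative
  values, which is possible because \<open>l \<Omega>\<close> is finite.
\<close>

lemma (in algebra) ca_pos_extension:
  assumes l: "l \<in> ca_pos M"
  shows "\<exists>l'\<in>ca_pos (sigma_sets \<Omega> M). \<forall>F\<in>M. l' F = l F"
proof -
  have add: "additive M l" and nn: "\<And>F. F \<in> M \<Longrightarrow> 0 \<le> l F"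
    and ca: "\<And>B :: nat \<Rightarrow> 'a set. range B \<subseteq> M \<Longrightarrow> disjoint_family B \<Longrightarrow> (\<Union>i. B i) \<in> M \<Longrightarrow>
      (\<lambda>i. l (B i)) sums l (\<Union>i. B i)"
    using l by (auto simp: ca_pos_def ca_def ba_def nonneg_on_def)
  have "positive M (\<lambda>F. ennreal (l F))"
    using additive_empty[OF add] by (simp add: positive_def)
  moreover have "countably_additive M (\<lambda>F. ennreal (l F))"
  proof (rule countably_additiveI)
    fix B :: "nat \<Rightarrow> 'a set" assume B: "range B \<subseteq> M" "disjoint_family B" "(\<Union>i. B i) \<in> M"
    show "(\<Sum>i. ennreal (l (B i))) = ennreal (l (\<Union>i. B i))"
      using B(1) nn by (intro suminf_ennreal_eq ca B) auto
  qed
  ultimately obtain \<mu> where \<mu>: "\<forall>F\<in>M. \<mu> F = ennreal (l F)" "measure_space \<Omega> (sigma_sets \<Omega> M) \<mu>"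
    using caratheodory' by blast
  define N where "N = measure_of \<Omega> M \<mu>"
  have sets: "sets N = sigma_sets \<Omega> M" and space: "space N = \<Omega>"
    using space_closed by (simp_all add: N_def)
  have em: "emeasure N F = ennreal (l F)" if "F \<in> M" for F
  proof -
    have "emeasure N F = \<mu> F"
      unfolding N_def
    proof (rule emeasure_measure_of[OF refl space_closed])
      show "F \<in> sets (measure_of \<Omega> M \<mu>)" using that sets by (auto simp: N_def)
    qed (use \<mu>(2) sets in \<open>auto simp: measure_space_def N_def\<close>)
    then show ?thesis using \<mu>(1) that by simp
  qed
  interpret N: finite_measure N
    by (rule finite_measureI) (simp add: space em)
  have "additive (sigma_sets \<Omega> M) (measure N)"
    unfolding additive_def using N.finite_measure_Union by (auto simp: sets)
  moreover have "bounded (measure N ` sigma_sets \<Omega> M)"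
    by (auto simp: bounded_real intro!: exI[of _ "measure N \<Omega>"] N.bounded_measure[unfolded space])
  moreover have "(\<lambda>i. measure N (B i)) sums measure N (\<Union>i. B i)"
    if "range B \<subseteq> sigma_sets \<Omega> M" "disjoint_family B" for B :: "nat \<Rightarrow> 'a set"
    using N.finite_measure_UNION that by (simp add: sets)
  ultimately have "measure N \<in> ca_pos (sigma_sets \<Omega> M)"
    by (auto simp: ca_pos_def ca_def ba_def nonneg_on_def)
  moreover have "measure N F = l F" if "F \<in> M" for F
    using em[OF that] nn[OF that] by (simp add: measure_def)
  ultimately show ?thesis by blast
qed

lemma slice_ba_pos:
  assumes x: "x \<in> ba_pos (Pow (time_product \<Omega>))" and T: "T \<subseteq> {0..}" and G: "algebra \<Omega> G"
  shows "(\<lambda>F. x (F \<times> T)) \<in> ba_pos G"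
proof -
  interpret algebra \<Omega> G by (rule G)
  have "additive (Pow \<Omega>) (\<lambda>F. x (F \<times> T))" "nonneg_on (Pow \<Omega>) (\<lambda>F. x (F \<times> T))"
    using x slice_additive[OF _ T] slice_nonneg[OF _ T] by (auto simp: ba_pos_def ba_def)
  then show ?thesis
    using space_closed by (intro ba_posI) (auto simp: nonneg_on_def intro: additive_subset)
qed

lemma slice_split:
  assumes "x \<in> ba_pos (Pow (time_product \<Omega>))" "F \<subseteq> \<Omega>" "S \<subseteq> {0..}" "T \<subseteq> {0..}" "S \<inter> T = {}"
  shows "x (F \<times> (S \<union> T)) = x (F \<times> S) + x (F \<times> T)"
proof -
  have "x (F \<times> S \<union> F \<times> T) = x (F \<times> S) + x (F \<times> T)"
    using assms by (intro additiveD[where M = "Pow (time_product \<Omega>)"])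
      (auto simp: ba_pos_def ba_def time_product_def)
  then show ?thesis by (simp add: Sigma_Un_distrib2)
qed

lemma algebra_union_algebra:
  assumes A: "algebra_filtration \<Omega> A"
  shows "algebra \<Omega> (union_algebra A)"
proof -
  note alg = filtration_algebra[OF A, unfolded algebra_iff_Un] and mono = filtration_mono[OF A]
  show ?thesis
    unfolding algebra_iff_Un
  proof (intro conjI ballI)
    show "union_algebra A \<subseteq> Pow \<Omega>" "{} \<in> union_algebra A"
      using alg by (fastforce simp: union_algebra_def)+
    fix a assume "a \<in> union_algebra A"
    then obtain s where s: "0 \<le> s" "a \<in> A s" by (auto simp: union_algebra_def)
    then show "\<Omega> - a \<in> union_algebra A" using alg[OF s(1)] by (auto simp: union_algebra_def)
    fix b assume "b \<in> union_algebra A"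
    then obtain t where t: "0 \<le> t" "b \<in> A t" by (auto simp: union_algebra_def)
    have "a \<in> A (max s t)" "b \<in> A (max s t)" using s t by (auto intro: mono[of s] mono[of t])
    moreover have "0 \<le> max s t" using s(1) by simp
    ultimately have "max s t \<in> {0..}" "a \<union> b \<in> A (max s t)" using alg[of "max s t"] by auto
    then show "a \<union> b \<in> union_algebra A" unfolding union_algebra_def by (rule UN_I)
  qed
qed

lemma algebra_time_cylinders:
  assumes A: "algebra_filtration \<Omega> A"
  shows "algebra (time_product \<Omega>) (time_cylinders \<Omega> A)"
proof -
  interpret U: algebra \<Omega> "union_algebra A" by (rule algebra_union_algebra[OF A])
  interpret S: sigma_algebra \<Omega> "sigma_sets \<Omega> (union_algebra A)"
    by (rule sigma_algebra_sigma_sets[OF U.space_closed])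
  show ?thesis
    unfolding algebra_iff_Un
  proof (intro conjI ballI)
    show "time_cylinders \<Omega> A \<subseteq> Pow (time_product \<Omega>)"
      using S.sets_into_space by (fastforce simp: time_cylinders_def time_product_def)
    show "{} \<in> time_cylinders \<Omega> A"
      unfolding time_cylinders_def by (auto intro!: exI[of _ "{}"])
    fix a assume "a \<in> time_cylinders \<Omega> A"
    then obtain F where F: "F \<in> sigma_sets \<Omega> (union_algebra A)" "a = F \<times> {0..}"
      by (auto simp: time_cylinders_def)
    have "time_product \<Omega> - a = (\<Omega> - F) \<times> {0..}" using F(2) by (auto simp: time_product_def)
    then show "time_product \<Omega> - a \<in> time_cylinders \<Omega> A"
      using S.compl_sets[OF F(1)] unfolding time_cylinders_def by blast
    fix b assume "b \<in> time_cylinders \<Omega> A"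
    then obtain F' where F': "F' \<in> sigma_sets \<Omega> (union_algebra A)" "b = F' \<times> {0..}"
      by (auto simp: time_cylinders_def)
    have "a \<union> b = (F \<union> F') \<times> {0..}" using F(2) F'(2) by auto
    then show "a \<union> b \<in> time_cylinders \<Omega> A"
      using S.Un[OF F(1) F'(1)] unfolding time_cylinders_def by blast
  qed
qed

text \<open>
  Cylinders \<open>F \<times> {0..}\<close> and their bases \<open>F\<close> correspond bijectively and compatibly with unions and
  disjointness, so countable additivity passes from either side to the other.
\<close>

lemma ca_time_cylinders:
  assumes l: "l \<in> ca (sigma_sets \<Omega> (union_algebra A))"
  shows "(\<lambda>C. l (fst ` C)) \<in> ca (time_cylinders \<Omega> A)"
proof -
  let ?S = "sigma_sets \<Omega> (union_algebra A)"
  have cyl: "fst ` C \<in> ?S" "C = fst ` C \<times> {0..}" if C: "C \<in> time_cylinders \<Omega> A" for C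
  proof -
    obtain F where "F \<in> ?S" "C = F \<times> {0..}" using C by (auto simp: time_cylinders_def)
    then show "fst ` C \<in> ?S" "C = fst ` C \<times> {0..}" by auto
  qed
  have disj: "fst ` C \<inter> fst ` D = {}"
    if "C \<in> time_cylinders \<Omega> A" "D \<in> time_cylinders \<Omega> A" "C \<inter> D = {}" for C D
  proof -
    have "(fst ` C \<inter> fst ` D) \<times> {0::real..} = {}"
      using cyl(2)[OF that(1)] cyl(2)[OF that(2)] that(3) by auto
    then show ?thesis by simp
  qed
  have "additive (time_cylinders \<Omega> A) (\<lambda>C. l (fst ` C))"
    using l cyl(1) disj unfolding additive_def ca_def ba_def by (simp add: image_Un)
  moreover have "bounded ((\<lambda>C. l (fst ` C)) ` time_cylinders \<Omega> A)"
    using l cyl(1) by (auto simp: ca_def ba_def bounded_real)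
  moreover have "(\<lambda>i. l (fst ` B i)) sums l (fst ` (\<Union>i. B i))"
    if B: "range B \<subseteq> time_cylinders \<Omega> A" "disjoint_family B" "(\<Union>i. B i) \<in> time_cylinders \<Omega> A"
    for B :: "nat \<Rightarrow> ('a \<times> real) set"
  proof -
    have "disjoint_family (\<lambda>i. fst ` B i)"
      using B(1,2) disj unfolding disjoint_family_on_def by (metis range_subsetD UNIV_I)
    moreover have "range (\<lambda>i. fst ` B i) \<subseteq> ?S" using B(1) cyl(1) by blast
    moreover have "(\<Union>i. fst ` B i) \<in> ?S" using cyl(1)[OF B(3)] by (simp add: image_UN)
    ultimately show ?thesis using l unfolding ca_def image_UN by blast
  qed
  ultimately show ?thesis by (simp add: ca_def ba_def)
qed

lemma ca_time_marginal:
  assumes x: "x \<in> ca (time_cylinders \<Omega> A)"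
  shows "(\<lambda>F. x (F \<times> {0..})) \<in> ca (union_algebra A)"
proof -
  have cyl: "F \<times> {0..} \<in> time_cylinders \<Omega> A" if "F \<in> union_algebra A" for F
    using that by (auto simp: time_cylinders_def)
  have "additive (union_algebra A) (\<lambda>F. x (F \<times> {0..}))"
    unfolding additive_def
  proof (intro ballI impI)
    fix F G assume FG: "F \<in> union_algebra A" "G \<in> union_algebra A" "F \<inter> G = {}"
    have "F \<times> {0::real..} \<inter> G \<times> {0..} = {}" using FG(3) by auto
    then show "x ((F \<union> G) \<times> {0..}) = x (F \<times> {0..}) + x (G \<times> {0..})"
      using x FG cyl by (simp add: ca_def ba_def additive_def Sigma_Un_distrib1)
  qed
  moreover have "bounded ((\<lambda>F. x (F \<times> {0..})) ` union_algebra A)"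
    using x cyl by (auto simp: ca_def ba_def bounded_real)
  moreover have "(\<lambda>i. x (B i \<times> {0..})) sums x ((\<Union>i. B i) \<times> {0..})"
    if B: "range B \<subseteq> union_algebra A" "disjoint_family B" "(\<Union>i. B i) \<in> union_algebra A"
    for B :: "nat \<Rightarrow> 'a set"
  proof -
    have eq: "(\<Union>i. B i) \<times> {0::real..} = (\<Union>i. B i \<times> {0..})" by auto
    have "range (\<lambda>i. B i \<times> {0..}) \<subseteq> time_cylinders \<Omega> A" using B(1) cyl by blast
    moreover have "disjoint_family (\<lambda>i. B i \<times> {0::real..})"
      using B(2) by (auto simp: disjoint_family_on_def)
    moreover have "(\<Union>i. B i \<times> {0..}) \<in> time_cylinders \<Omega> A" using cyl[OF B(3)] unfolding eq .
    ultimately show ?thesis using x unfolding ca_def eq by blast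
  qed
  ultimately show ?thesis by (simp add: ca_def ba_def)
qed

section \<open>Bounded finitely additive supermartingales\<close>

lemma lim_value_eqI:
  assumes "((\<lambda>t. \<xi> t F) \<longlongrightarrow> c) at_top"
  shows "lim_value \<xi> F = c"
  unfolding lim_value_def using assms by (intro tendsto_Lim) simp_all

locale bounded_supermartingale =
  fixes \<Omega> :: "'a set" and A :: "real \<Rightarrow> 'a set set" and \<xi> :: "real \<Rightarrow> 'a set \<Rightarrow> real"
  assumes filtration: "algebra_filtration \<Omega> A"
    and supermartingale: "\<xi> \<in> bdd_supermartingales \<Omega> A"
begin

sublocale U: algebra \<Omega> "union_algebra A"
  by (rule algebra_union_algebra[OF filtration])

lemma in_union: "0 \<le> t \<Longrightarrow> F \<in> A t \<Longrightarrow> F \<in> union_algebra A"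
  by (auto simp: union_algebra_def)

lemma subset_union: "0 \<le> t \<Longrightarrow> A t \<subseteq> union_algebra A"
  by (auto simp: union_algebra_def)

lemma union_cases:
  assumes "F \<in> union_algebra A"
  obtains t where "0 \<le> t" "F \<in> A t"
  using assms by (auto simp: union_algebra_def)

lemma common_time:
  assumes "F \<in> union_algebra A" "G \<in> union_algebra A"
  obtains t where "0 \<le> t" "F \<in> A t" "G \<in> A t"
proof -
  obtain s where s: "0 \<le> s" "F \<in> A s" using assms(1) by (rule union_cases)
  obtain t where t: "0 \<le> t" "G \<in> A t" using assms(2) by (rule union_cases)
  show ?thesis
    using that[of "max s t"] s t filtration_mono[OF filtration s(1), of "max s t"]
      filtration_mono[OF filtration t(1), of "max s t"] by simp
qed

lemma xi_ba: "0 \<le> t \<Longrightarrow> \<xi> t \<in> ba (A t)"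
  using supermartingale by (auto simp: bdd_supermartingales_def fa_supermartingale_def fa_process_def)

lemma xi_antimono: "0 \<le> s \<Longrightarrow> s \<le> t \<Longrightarrow> F \<in> A s \<Longrightarrow> \<xi> t F \<le> \<xi> s F"
  using supermartingale by (auto simp: bdd_supermartingales_def fa_supermartingale_def)

lemma xi_bounded: "\<exists>C. \<forall>t\<ge>0. \<forall>F\<in>A t. \<bar>\<xi> t F\<bar> \<le> C"
proof -
  obtain C where C: "\<And>t. 0 \<le> t \<Longrightarrow> tv_norm \<Omega> (A t) (\<xi> t) \<le> C"
    using supermartingale by (auto simp: bdd_supermartingales_def bdd_above_def)
  have "\<bar>\<xi> t F\<bar> \<le> C" if t: "0 \<le> t" and F: "F \<in> A t" for t F
  proof -
    interpret algebra \<Omega> "A t" by (rule filtration_algebra[OF filtration t])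
    have "\<bar>\<xi> t F\<bar> \<le> tv_norm \<Omega> (A t) (\<xi> t)"
      unfolding tv_norm_def using F sets_into_space by (intro abs_le_variation xi_ba t) auto
    with C[OF t] show ?thesis by simp
  qed
  then show ?thesis by blast
qed

lemma bdd_below_values: "bdd_below ((\<lambda>t. \<xi> t F) ` {t. 0 \<le> t \<and> F \<in> A t})"
proof -
  obtain C where "\<forall>t\<ge>0. \<forall>F\<in>A t. \<bar>\<xi> t F\<bar> \<le> C" using xi_bounded ..
  then show ?thesis by (intro bdd_belowI2[where m = "- C"]) (fastforce simp: abs_le_iff)
qed

lemma inf_value_le: "0 \<le> t \<Longrightarrow> F \<in> A t \<Longrightarrow> inf_value A \<xi> F \<le> \<xi> t F"
  unfolding inf_value_def by (intro cINF_lower bdd_below_values) simp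

lemma tendsto_inf_value:
  assumes F: "F \<in> union_algebra A"
  shows "((\<lambda>t. \<xi> t F) \<longlongrightarrow> inf_value A \<xi> F) at_top"
proof (rule order_tendstoI)
  obtain t where t: "0 \<le> t" "F \<in> A t" using F by (rule union_cases)
  fix a assume a: "a < inf_value A \<xi> F"
  show "\<forall>\<^sub>F u in at_top. a < \<xi> u F"
    using eventually_ge_at_top[of t]
  proof eventually_elim
    case (elim u)
    then show ?case
      using a inf_value_le[of u F] t filtration_mono[OF filtration t(1) _ t(2), of u] by simp
  qed
next
  obtain t where t: "0 \<le> t" "F \<in> A t" using F by (rule union_cases)
  fix a assume "inf_value A \<xi> F < a"
  moreover have "{t. 0 \<le> t \<and> F \<in> A t} \<noteq> {}" using t by auto
  ultimately obtain s where s: "0 \<le> s" "F \<in> A s" "\<xi> s F < a"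
    unfolding inf_value_def using cINF_less_iff[OF _ bdd_below_values] by auto
  show "\<forall>\<^sub>F u in at_top. \<xi> u F < a"
    using eventually_ge_at_top[of s]
  proof eventually_elim
    case (elim u)
    then show ?case using xi_antimono[OF s(1) elim s(2)] s(3) by simp
  qed
qed

lemma abs_inf_value_le:
  assumes F: "F \<in> union_algebra A" and le: "\<And>t. 0 \<le> t \<Longrightarrow> F \<in> A t \<Longrightarrow> \<bar>\<xi> t F\<bar> \<le> c"
  shows "\<bar>inf_value A \<xi> F\<bar> \<le> c"
proof -
  obtain t where t: "0 \<le> t" "F \<in> A t" using F by (rule union_cases)
  have "\<forall>\<^sub>F u in at_top. \<bar>\<xi> u F\<bar> \<le> c"
    using eventually_ge_at_top[of t]
    by eventually_elim (use t le filtration_mono[OF filtration t(1) _ t(2)] in auto)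
  then show ?thesis
    by (intro tendsto_upperbound[OF tendsto_rabs[OF tendsto_inf_value[OF F]]]) auto
qed

lemma inf_value_ba: "inf_value A \<xi> \<in> ba (union_algebra A)"
proof -
  obtain C where C: "\<forall>t\<ge>0. \<forall>F\<in>A t. \<bar>\<xi> t F\<bar> \<le> C" using xi_bounded ..
  then have "\<bar>inf_value A \<xi> F\<bar> \<le> C" if "F \<in> union_algebra A" for F
    using that by (intro abs_inf_value_le) auto
  moreover have "additive (union_algebra A) (inf_value A \<xi>)"
    unfolding additive_def
  proof (intro ballI impI)
    fix F G assume FG: "F \<in> union_algebra A" "G \<in> union_algebra A" "F \<inter> G = {}"
    obtain t where t: "0 \<le> t" "F \<in> A t" "G \<in> A t" using FG(1,2) by (rule common_time)
    have "\<forall>\<^sub>F u in at_top. \<xi> u F + \<xi> u G = \<xi> u (F \<union> G)"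
      using eventually_ge_at_top[of t]
    proof eventually_elim
      case (elim u)
      then have "F \<in> A u" "G \<in> A u" "\<xi> u \<in> ba (A u)"
        using t filtration_mono[OF filtration t(1) elim] xi_ba by auto
      then show ?case using FG(3) by (simp add: ba_def additive_def)
    qed
    then have "((\<lambda>u. \<xi> u (F \<union> G)) \<longlongrightarrow> inf_value A \<xi> F + inf_value A \<xi> G) at_top"
      using tendsto_add[OF tendsto_inf_value[OF FG(1)] tendsto_inf_value[OF FG(2)]]
      by (rule Lim_transform_eventually[rotated])
    then show "inf_value A \<xi> (F \<union> G) = inf_value A \<xi> F + inf_value A \<xi> G"
      using tendsto_inf_value[OF U.Un[OF FG(1,2)]] tendsto_unique trivial_limit_at_top_linorder by blast
  qed
  ultimately show ?thesis by (auto simp: ba_def bounded_real)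
qed

text \<open>
  The part of \<open>\<xi>\<close> that is lost in the limit; it plays the role of the potential in the Riesz
  decomposition of \<open>\<xi>\<close>, the martingale part being \<open>inf_value A \<xi>\<close>.
\<close>

definition potential :: "real \<Rightarrow> 'a set \<Rightarrow> real" where
  "potential t F = \<xi> t F - inf_value A \<xi> F"

lemma potential_additive:
  assumes "0 \<le> t"
  shows "additive (A t) (potential t)"
proof -
  have "(\<lambda>F. \<xi> t F + (- 1) * inf_value A \<xi> F) \<in> ba (A t)"
    by (intro ba_add ba_cmult xi_ba ba_subset[OF inf_value_ba subset_union] assms)
  then show ?thesis by (simp add: ba_def potential_def[abs_def])
qed

lemma potential_nonneg: "0 \<le> t \<Longrightarrow> nonneg_on (A t) (potential t)"
  using inf_value_le by (simp add: nonneg_on_def potential_def)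

lemma potential_antimono: "0 \<le> s \<Longrightarrow> s \<le> t \<Longrightarrow> F \<in> A s \<Longrightarrow> potential t F \<le> potential s F"
  using xi_antimono by (simp add: potential_def)

text \<open>
  The tail condition defining \<open>prod_measures\<close> comes for free: \<open>\<xi> t \<Omega>\<close> decreases to its infimum.
\<close>

lemma prod_measures_ofI:
  assumes x: "x \<in> ba_pos (Pow (time_product \<Omega>))"
    and eq: "\<forall>t\<ge>0. \<forall>F\<in>A t. x (F \<times> {t<..}) = potential t F"
  shows "x \<in> prod_measures_of \<Omega> A \<xi>"
proof -
  have "((\<lambda>t. \<xi> t \<Omega> - inf_value A \<xi> \<Omega>) \<longlongrightarrow> 0) at_top"
    using tendsto_diff[OF tendsto_inf_value[OF U.top] tendsto_const[of "inf_value A \<xi> \<Omega>"]] by simp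
  moreover have "\<forall>\<^sub>F t in at_top. \<xi> t \<Omega> - inf_value A \<xi> \<Omega> = x (\<Omega> \<times> {t<..})"
    using eventually_ge_at_top[of 0]
  proof eventually_elim
    case (elim t)
    then show ?case
      using eq algebra.top[OF filtration_algebra[OF filtration elim]] by (simp add: potential_def)
  qed
  ultimately have "((\<lambda>t. x (\<Omega> \<times> {t<..})) \<longlongrightarrow> 0) at_top"
    by (rule Lim_transform_eventually)
  then show ?thesis
    using x eq by (simp add: prod_measures_of_def prod_measures_def potential_def)
qed

lemma prod_measures_of_nonempty: "prod_measures_of \<Omega> A \<xi> \<noteq> {}"
proof -
  interpret Z: algebra "time_product \<Omega>" "Pow (time_product \<Omega>)" by (rule algebra_Pow)
  obtain x where "additive (Pow (time_product \<Omega>)) x" "nonneg_on (Pow (time_product \<Omega>)) x"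
    "\<forall>t\<ge>0. \<forall>F\<in>A t. x (F \<times> {t<..}) = potential t F"
    using potential_representation_unconstrained[OF filtration potential_additive potential_nonneg potential_antimono]
    by blast
  then show ?thesis using prod_measures_ofI[of x] Z.ba_posI by blast
qed

section \<open>Decompositions and countable additivity\<close>

text \<open>
  Split the mass of \<open>F\<close> after time \<open>0\<close> at time \<open>t\<close>. What lies in \<open>{0<..t}\<close> is the increasing process,
  what lies beyond \<open>t\<close> is the potential of \<open>\<xi>\<close>, and the two together do not depend on \<open>t\<close>, which
  makes \<open>\<mu> = \<xi> + \<alpha>\<close> a martingale. The formula for \<open>\<alpha>\<close> makes sense on the whole of
  \<open>union_algebra A\<close> at each time, so \<open>\<alpha>\<close> is its own increasing extension.
\<close>

lemma decomposition_of_prod_measure: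
  assumes x: "x \<in> prod_measures_of \<Omega> A \<xi>"
  defines "\<mu> \<equiv> \<lambda>t::real. \<lambda>F. inf_value A \<xi> F + x (F \<times> {0<..})" and "\<alpha> \<equiv> \<lambda>t F. x (F \<times> {0<..t})"
  shows "fa_decomposition \<Omega> A \<xi> \<mu> \<alpha>"
    and "F \<in> union_algebra A \<Longrightarrow> lim_value \<mu> F = inf_value A \<xi> F + x (F \<times> {0<..})"
    and "F \<in> union_algebra A \<Longrightarrow> lim_value \<alpha> F = x (F \<times> {0<..})"
proof -
  let ?Z = "time_product \<Omega>"
  interpret Z: algebra ?Z "Pow ?Z" by (rule algebra_Pow)
  have xb: "x \<in> ba_pos (Pow ?Z)" using x by (simp add: prod_measures_of_def prod_measures_def)
  have repr: "\<xi> t F = inf_value A \<xi> F + x (F \<times> {t<..})" if "0 \<le> t" "F \<in> A t" for t F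
    using x that by (simp add: prod_measures_of_def)
  have split: "x (F \<times> {0<..}) = x (F \<times> {0<..t}) + x (F \<times> {t<..})" if "0 \<le> t" "F \<subseteq> \<Omega>" for t F
  proof -
    have eq: "{0<..} = {0<..t} \<union> {t<..}" using that(1) by auto
    show ?thesis unfolding eq using that by (intro slice_split[OF xb]) auto
  qed
  have xmono: "x B \<le> x C" if "B \<subseteq> C" "C \<subseteq> ?Z" for B C
    using xb that by (intro Z.additive_mono) (auto simp: ba_pos_def ba_def)
  have T: "{0<..} \<subseteq> {0::real..}" "{0<..t} \<subseteq> {0::real..}" for t :: real by auto
  have dec: "\<xi> t F = \<mu> t F - \<alpha> t F" if t: "0 \<le> t" and F: "F \<in> A t" for t F
    using repr[OF t F] split[OF t U.sets_into_space[OF in_union[OF t F]]]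
    by (simp add: \<mu>_def \<alpha>_def)
  have "fa_martingale A \<mu>"
  proof -
    have "(\<lambda>F. inf_value A \<xi> F + x (F \<times> {0<..})) \<in> ba (union_algebra A)"
      using slice_ba_pos[OF xb T(1) U.algebra_axioms]
      by (intro ba_add inf_value_ba) (simp add: ba_pos_def)
    then show ?thesis
      using subset_union by (auto simp: fa_martingale_def fa_process_def \<mu>_def intro: ba_subset)
  qed
  moreover have "fa_increasing_process \<Omega> A \<alpha>"
  proof -
    have \<alpha>_pos: "\<alpha> t \<in> ba_pos G" if "algebra \<Omega> G" for t G
      using slice_ba_pos[OF xb T(2) that] by (simp add: \<alpha>_def)
    have norm0: "tv_norm \<Omega> G (\<alpha> 0) = 0" if "algebra \<Omega> G" for G
    proof -
      interpret G: algebra \<Omega> G by (rule that)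
      have "\<alpha> 0 F = 0" for F
        using additive_empty[of "Pow ?Z" x] xb by (simp add: \<alpha>_def ba_pos_def ba_def)
      then have "variation G (\<alpha> 0) \<Omega> \<le> 0"
        using G.variation_le[of "\<lambda>_. 0" "\<alpha> 0" \<Omega>] by (simp add: additive_def)
      moreover have "\<bar>\<alpha> 0 \<Omega>\<bar> \<le> variation G (\<alpha> 0) \<Omega>"
        using \<alpha>_pos[OF that] by (intro G.abs_le_variation) (auto simp: ba_pos_def)
      ultimately show ?thesis by (simp add: tv_norm_def)
    qed
    have "(INF t\<in>{0..}. tv_norm \<Omega> (union_algebra A) (\<alpha> t)) = 0"
    proof (rule cInf_eq_minimum)
      show "0 \<in> (\<lambda>t. tv_norm \<Omega> (union_algebra A) (\<alpha> t)) ` {0..}"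
        using norm0[OF U.algebra_axioms] by force
      fix r assume "r \<in> (\<lambda>t. tv_norm \<Omega> (union_algebra A) (\<alpha> t)) ` {0..}"
      then obtain t where r: "r = variation (union_algebra A) (\<alpha> t) \<Omega>" by (auto simp: tv_norm_def)
      have "\<bar>\<alpha> t \<Omega>\<bar> \<le> variation (union_algebra A) (\<alpha> t) \<Omega>"
        using \<alpha>_pos[OF U.algebra_axioms] by (intro U.abs_le_variation) (auto simp: ba_pos_def)
      then show "0 \<le> r" using r by simp
    qed
    moreover have "tv_norm \<Omega> (A 0) (\<alpha> 0) = 0"
      by (rule norm0[OF filtration_algebra[OF filtration order_refl]])
    moreover have "\<alpha> s F \<le> \<alpha> t F" if "s \<le> t" "F \<in> union_algebra A" for s t F
      unfolding \<alpha>_def using that U.sets_into_space[OF that(2)]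
      by (intro xmono) (auto simp: time_product_def)
    ultimately show ?thesis
      unfolding fa_increasing_process_def
      using \<alpha>_pos[OF U.algebra_axioms] \<alpha>_pos[OF filtration_algebra[OF filtration]]
      by (intro conjI exI[of _ \<alpha>]) auto
  qed
  ultimately show "fa_decomposition \<Omega> A \<xi> \<mu> \<alpha>" using dec by (simp add: fa_decomposition_def)
  show "lim_value \<mu> F = inf_value A \<xi> F + x (F \<times> {0<..})" if "F \<in> union_algebra A"
    by (rule lim_value_eqI) (simp add: \<mu>_def)
  show "lim_value \<alpha> F = x (F \<times> {0<..})" if F: "F \<in> union_algebra A"
  proof (rule lim_value_eqI)
    obtain t where t: "0 \<le> t" "F \<in> A t" using F by (rule union_cases)
    have "((\<lambda>u. x (F \<times> {0<..}) + inf_value A \<xi> F - \<xi> u F) \<longlongrightarrow>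
        x (F \<times> {0<..}) + inf_value A \<xi> F - inf_value A \<xi> F) at_top"
      by (intro tendsto_diff tendsto_const tendsto_inf_value F)
    moreover have "\<forall>\<^sub>F u in at_top. x (F \<times> {0<..}) + inf_value A \<xi> F - \<xi> u F = \<alpha> u F"
      using eventually_ge_at_top[of t]
    proof eventually_elim
      case (elim u)
      then show ?case
        using dec[of u F] t filtration_mono[OF filtration t(1) elim t(2)] by (simp add: \<mu>_def)
    qed
    ultimately show "((\<lambda>u. \<alpha> u F) \<longlongrightarrow> x (F \<times> {0<..})) at_top"
      using Lim_transform_eventually by fastforce
  qed
qed

lemma lim_value_martingale:
  assumes "fa_martingale A \<mu>" "0 \<le> t" "F \<in> A t"
  shows "lim_value \<mu> F = \<mu> t F"
proof (rule lim_value_eqI, rule tendsto_eventually)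
  show "\<forall>\<^sub>F u in at_top. \<mu> u F = \<mu> t F"
    using eventually_ge_at_top[of t]
    by eventually_elim (use assms in \<open>auto simp: fa_martingale_def\<close>)
qed

text \<open>
  For \<open>F \<in> A t\<close> and from time \<open>t\<close> on, \<open>\<alpha> u F\<close> differs from \<open>- \<xi> u F\<close> by the constant \<open>\<mu> t F\<close>, so it
  increases, and it converges because \<open>\<xi>\<close> does.
\<close>

lemma increasing_le_lim_value:
  assumes dec: "fa_decomposition \<Omega> A \<xi> \<mu> \<alpha>" and t: "0 \<le> t" and F: "F \<in> A t"
  shows "\<alpha> t F \<le> lim_value \<alpha> F"
proof -
  have eq: "\<alpha> u F = \<mu> t F - \<xi> u F" if "t \<le> u" for u
  proof -
    have "F \<in> A u" by (rule filtration_mono[OF filtration t that F])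
    then have "\<xi> u F = \<mu> u F - \<alpha> u F" using dec t that by (simp add: fa_decomposition_def)
    moreover have "\<mu> t F = \<mu> u F"
      using dec t that F by (simp add: fa_decomposition_def fa_martingale_def)
    ultimately show ?thesis by simp
  qed
  have "lim_value \<alpha> F = \<mu> t F - inf_value A \<xi> F"
  proof (rule lim_value_eqI, rule Lim_transform_eventually)
    show "((\<lambda>u. \<mu> t F - \<xi> u F) \<longlongrightarrow> \<mu> t F - inf_value A \<xi> F) at_top"
      by (intro tendsto_diff tendsto_const tendsto_inf_value in_union[OF t F])
    show "\<forall>\<^sub>F u in at_top. \<mu> t F - \<xi> u F = \<alpha> u F"
      using eventually_ge_at_top[of t] by eventually_elim (simp add: eq)
  qed
  then show ?thesis using eq[of t] inf_value_le[OF t F] by simp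
qed

text \<open>
  In the decomposition given by \<open>x\<close>, the terminal value of \<open>\<alpha>\<close> is the mass after time \<open>0\<close>. It is
  dominated by the full time marginal of \<open>x\<close>, which is countably additive by hypothesis.
\<close>

lemma ca_decomposition_of_uc:
  assumes uc: "\<xi> \<in> uc_supermartingales \<Omega> A"
  shows "\<exists>\<mu> \<alpha>. fa_decomposition \<Omega> A \<xi> \<mu> \<alpha> \<and>
    lim_value \<mu> \<in> ca (union_algebra A) \<and> lim_value \<alpha> \<in> ca (union_algebra A)"
proof -
  let ?Z = "time_product \<Omega>"
  interpret Z: algebra ?Z "Pow ?Z" by (rule algebra_Pow)
  obtain x where inf: "inf_value A \<xi> \<in> ca (union_algebra A)" and x: "x \<in> prod_measures_of \<Omega> A \<xi>"
    and xca: "x \<in> ca (time_cylinders \<Omega> A)"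
    using uc by (auto simp: uc_supermartingales_def prod_measures_uc_def)
  have xb: "x \<in> ba_pos (Pow ?Z)" using x by (simp add: prod_measures_of_def prod_measures_def)
  have T: "{0<..} \<subseteq> {0::real..}" by auto
  have sl: "(\<lambda>F. x (F \<times> {0<..})) \<in> ba_pos (union_algebra A)"
    by (rule slice_ba_pos[OF xb T U.algebra_axioms])
  have "\<bar>x (F \<times> {0<..})\<bar> \<le> x (F \<times> {0..})" if F: "F \<in> union_algebra A" for F
  proof -
    have "0 \<le> x (F \<times> {0<..})" using sl F by (simp add: ba_pos_def nonneg_on_def)
    moreover have "x (F \<times> {0<..}) \<le> x (F \<times> {0..})"
      using xb U.sets_into_space[OF F]
      by (intro Z.additive_mono) (auto simp: ba_pos_def ba_def time_product_def)
    ultimately show ?thesis by simp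
  qed
  then have ca0: "(\<lambda>F. x (F \<times> {0<..})) \<in> ca (union_algebra A)"
    using sl by (intro U.ca_dominated[OF _ ca_time_marginal[OF xca]]) (auto simp: ba_pos_def ba_def)
  note d = decomposition_of_prod_measure[OF x]
  show ?thesis
    using d(1) U.ca_cong[OF ca_add[OF inf ca0] d(2)] U.ca_cong[OF ca0 d(3)] by blast
qed

text \<open>
  From \<open>\<xi> t F = lim_value \<mu> F - \<alpha> t F\<close> and \<open>0 \<le> \<alpha> t F \<le> lim_value \<alpha> F\<close>, the set function \<open>\<xi> t\<close> lies
  below the sum of the terminal value of \<open>\<alpha>\<close> and a countably additive dominant of that of \<open>\<mu>\<close>.
\<close>

lemma dominated_of_ca_decomposition:
  assumes dec: "fa_decomposition \<Omega> A \<xi> \<mu> \<alpha>"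
    and \<mu>: "lim_value \<mu> \<in> ca (union_algebra A)" and \<alpha>: "lim_value \<alpha> \<in> ca (union_algebra A)"
  shows "\<exists>l\<in>ca_pos (union_algebra A). \<forall>t\<ge>0. \<forall>F\<in>A t. variation (A t) (\<xi> t) F \<le> l F"
proof -
  obtain k where k: "k \<in> ca_pos (union_algebra A)" "\<forall>F\<in>union_algebra A. \<bar>lim_value \<mu> F\<bar> \<le> k F"
    using U.ca_pos_dominating[OF \<mu>] by blast
  define l where "l F = k F + lim_value \<alpha> F" for F
  have \<alpha>0: "0 \<le> \<alpha> t F" if "0 \<le> t" "F \<in> A t" for t F
    using dec that
    by (simp add: fa_decomposition_def fa_increasing_process_def ba_pos_def nonneg_on_def)
  have lca: "l \<in> ca (union_algebra A)"
    unfolding l_def[abs_def] using k(1) \<alpha> by (intro ca_add) (auto simp: ca_pos_def)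
  have le: "\<bar>\<xi> t F\<bar> \<le> l F" if t: "0 \<le> t" and F: "F \<in> A t" for t F
  proof -
    have "\<xi> t F = lim_value \<mu> F - \<alpha> t F"
      using dec t F lim_value_martingale[of \<mu> t F] by (simp add: fa_decomposition_def)
    then show ?thesis
      using k(2) in_union[OF t F] \<alpha>0[OF t F] increasing_le_lim_value[OF dec t F]
      unfolding l_def by fastforce
  qed
  have "nonneg_on (union_algebra A) l"
    unfolding nonneg_on_def using le by (meson abs_ge_zero order_trans union_cases)
  with lca have "l \<in> ca_pos (union_algebra A)" by (simp add: ca_pos_def)
  moreover have "variation (A t) (\<xi> t) F \<le> l F" if t: "0 \<le> t" and F: "F \<in> A t" for t F
  proof -
    interpret algebra \<Omega> "A t" by (rule filtration_algebra[OF filtration t])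
    have "additive (A t) l"
      using lca by (intro additive_subset[OF _ subset_union[OF t]]) (simp add: ca_def ba_def)
    then show ?thesis using le[OF t] F by (intro variation_le)
  qed
  ultimately show ?thesis by blast
qed

text \<open>
  Both \<open>\<xi> t\<close> and its infimum lie below \<open>l\<close> in modulus, so the potential lies below \<open>2 * l\<close>. Extend
  \<open>2 * l\<close> to a countably additive \<open>l'\<close> on the generated sigma-algebra, and that to an additive \<open>\<rho>\<close> on
  all subsets, where finite additivity suffices. A representing \<open>x\<close> whose time marginal lies below
  \<open>\<rho>\<close> is then dominated by \<open>l'\<close> on cylinders over the sigma-algebra.
\<close>

lemma uc_of_dominated:
  assumes l: "l \<in> ca_pos (union_algebra A)"
    and le: "\<forall>t\<ge>0. \<forall>F\<in>A t. variation (A t) (\<xi> t) F \<le> l F"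
  shows "\<xi> \<in> uc_supermartingales \<Omega> A"
proof -
  let ?Z = "time_product \<Omega>" and ?S = "sigma_sets \<Omega> (union_algebra A)"
  interpret Z: algebra ?Z "Pow ?Z" by (rule algebra_Pow)
  interpret S: sigma_algebra \<Omega> ?S by (rule sigma_algebra_sigma_sets[OF U.space_closed])
  interpret C: algebra ?Z "time_cylinders \<Omega> A" by (rule algebra_time_cylinders[OF filtration])
  have \<xi>_le: "\<bar>\<xi> t F\<bar> \<le> l F" if t: "0 \<le> t" and F: "F \<in> A t" for t F
  proof -
    interpret algebra \<Omega> "A t" by (rule filtration_algebra[OF filtration t])
    have "\<bar>\<xi> t F\<bar> \<le> variation (A t) (\<xi> t) F" using F by (intro abs_le_variation xi_ba[OF t]) auto
    then show ?thesis using le t F by fastforce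
  qed
  have inf_le: "\<bar>inf_value A \<xi> F\<bar> \<le> l F" if "F \<in> union_algebra A" for F
    using that \<xi>_le by (intro abs_inf_value_le) auto
  have lca: "l \<in> ca (union_algebra A)" using l by (simp add: ca_pos_def)
  have inf_ca: "inf_value A \<xi> \<in> ca (union_algebra A)"
    using inf_value_ba inf_le by (intro U.ca_dominated[OF _ lca]) (auto simp: ba_def)
  have l2: "(\<lambda>F. 2 * l F) \<in> ca_pos (union_algebra A)"
    using l ca_cmult[of l _ 2] by (auto simp: ca_pos_def nonneg_on_def)
  obtain l' where l': "l' \<in> ca_pos ?S" "\<forall>F\<in>union_algebra A. l' F = 2 * l F"
    using U.ca_pos_extension[OF l2] by blast
  obtain \<rho> where \<rho>: "additive (Pow \<Omega>) \<rho>" "nonneg_on (Pow \<Omega>) \<rho>" "\<forall>F\<in>?S. \<rho> F = l' F"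
    using S.positive_extension[of l'] l'(1) by (auto simp: ca_pos_def ca_def ba_def)
  have pot_le: "potential t F \<le> \<rho> F" if t: "0 \<le> t" and F: "F \<in> A t" for t F
  proof -
    have FU: "F \<in> union_algebra A" by (rule in_union[OF t F])
    then have "\<rho> F = 2 * l F" using \<rho>(3) l'(2) by simp
    then show ?thesis using \<xi>_le[OF t F] inf_le[OF FU] unfolding potential_def by linarith
  qed
  obtain x where x: "additive (Pow ?Z) x" "nonneg_on (Pow ?Z) x"
    and x_le: "\<forall>B\<subseteq>\<Omega>. x (B \<times> {0..}) \<le> \<rho> B"
    and x_t: "\<forall>t\<ge>0. \<forall>F\<in>A t. x (F \<times> {t<..}) = potential t F"
    using potential_representation_dominated[OF filtration potential_additive potential_nonneg
        potential_antimono \<rho>(1,2) pot_le] by blast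
  have xof: "x \<in> prod_measures_of \<Omega> A \<xi>"
    using Z.ba_posI[OF x] x_t by (rule prod_measures_ofI)
  have "x \<in> ca (time_cylinders \<Omega> A)"
  proof (rule C.ca_dominated)
    show "additive (time_cylinders \<Omega> A) x" by (rule additive_subset[OF x(1) C.space_closed])
    show "(\<lambda>C. l' (fst ` C)) \<in> ca (time_cylinders \<Omega> A)"
      using l'(1) by (intro ca_time_cylinders) (simp add: ca_pos_def)
    fix C assume C: "C \<in> time_cylinders \<Omega> A"
    then obtain F where F: "F \<in> ?S" "C = F \<times> {0..}" by (auto simp: time_cylinders_def)
    have "0 \<le> x C" using x(2) C.sets_into_space[OF C] by (simp add: nonneg_on_def)
    moreover have "x C \<le> l' F"
      using x_le S.sets_into_space[OF F(1)] \<rho>(3) F by metis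
    moreover have "fst ` C = F" using F(2) by auto
    ultimately show "\<bar>x C\<bar> \<le> l' (fst ` C)" by simp
  qed
  then have "x \<in> prod_measures_uc \<Omega> A"
    using xof by (simp add: prod_measures_uc_def prod_measures_of_def)
  then show ?thesis using xof inf_ca supermartingale by (auto simp: uc_supermartingales_def)
qed

lemma ca_processes_of_ca_limits:
  assumes dec: "fa_decomposition \<Omega> A \<xi> \<mu> \<alpha>"
    and \<mu>: "lim_value \<mu> \<in> ca (union_algebra A)" and \<alpha>: "lim_value \<alpha> \<in> ca (union_algebra A)"
  shows "ca_process A \<mu> \<and> ca_process A \<alpha>"
proof -
  have mart: "fa_martingale A \<mu>" using dec by (simp add: fa_decomposition_def)
  have "\<mu> t \<in> ca (A t) \<and> \<alpha> t \<in> ca (A t)" if t: "0 \<le> t" for t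
  proof
    interpret algebra \<Omega> "A t" by (rule filtration_algebra[OF filtration t])
    have ca: "lim_value \<mu> \<in> ca (A t)" "lim_value \<alpha> \<in> ca (A t)"
      using \<mu> \<alpha> subset_union[OF t] by (auto intro: ca_subset)
    show "\<mu> t \<in> ca (A t)"
      using ca(1) by (rule ca_cong) (simp add: lim_value_martingale[OF mart t])
    have "\<alpha> t \<in> ba_pos (A t)"
      using dec t by (simp add: fa_decomposition_def fa_increasing_process_def)
    then show "\<alpha> t \<in> ca (A t)"
      using increasing_le_lim_value[OF dec t]
      by (intro ca_dominated[OF _ ca(2)]) (auto simp: ba_pos_def ba_def nonneg_on_def)
  qed
  then show ?thesis by (simp add: ca_process_def)
qed

end

theorem corollary1:
  fixes \<Omega> :: "'a set" and A :: "real \<Rightarrow> 'a set set" and \<xi> :: "real \<Rightarrow> 'a set \<Rightarrow> real"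
  assumes "algebra_filtration \<Omega> A"
    and "\<xi> \<in> bdd_supermartingales \<Omega> A"
  shows "(\<exists>\<mu> \<alpha>. fa_decomposition \<Omega> A \<xi> \<mu> \<alpha>) \<and>
         (\<xi> \<in> uc_supermartingales \<Omega> A \<longleftrightarrow>
            (\<exists>\<mu> \<alpha>. fa_decomposition \<Omega> A \<xi> \<mu> \<alpha> \<and>
               lim_value \<mu> \<in> ca (union_algebra A) \<and> lim_value \<alpha> \<in> ca (union_algebra A))) \<and>
         (\<xi> \<in> uc_supermartingales \<Omega> A \<longleftrightarrow>
            (\<exists>l\<in>ca_pos (union_algebra A). \<forall>t\<ge>0. \<forall>F\<in>A t. variation (A t) (\<xi> t) F \<le> l F)) \<and>
         (\<forall>\<mu> \<alpha>. fa_decomposition \<Omega> A \<xi> \<mu> \<alpha> \<and>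
            lim_value \<mu> \<in> ca (union_algebra A) \<and> lim_value \<alpha> \<in> ca (union_algebra A) \<longrightarrow>
            ca_process A \<mu> \<and> ca_process A \<alpha>)"
proof -
  interpret bounded_supermartingale \<Omega> A \<xi> by unfold_locales (fact assms)+
  have "\<exists>\<mu> \<alpha>. fa_decomposition \<Omega> A \<xi> \<mu> \<alpha>"
    using prod_measures_of_nonempty decomposition_of_prod_measure(1) by blast
  moreover note ca_decomposition_of_uc dominated_of_ca_decomposition uc_of_dominated
    ca_processes_of_ca_limits
  ultimately show ?thesis by blast
qed

end
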